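(* Let $\{\varrho_\theta\}$ be a smooth family of density operators on $\mathcal H$ depending on real parameters $\theta=(\theta_1,\dots,\theta_n)$ in an open subset of $\mathbb R^n$, and suppose there exist Hermitian operators $\hat p_k=\hat p_k(\theta)$, $k=1,\dots,n$, solving $$\varrho_\theta\hat p_k-\hat p_k\varrho_\theta=\frac{\hbar}{\mathrm i}\frac{\partial}{\partial\theta_k}\varrho_\theta .$$ Let $\mathsf S_\theta=[S_{ik}(\theta)]$, $S_{ik}(\theta)=\mathrm{Tr}\big[\tfrac12(\hat p_i\hat p_k+\hat p_k\hat p_i)\varrho_\theta\big]$, be nondegenerate. Let $\Pi(\mathrm d\lambda)$ be a quantum probability measure on $\mathbb R^n$ whose results are unbiased estimates of $\theta$, i.e. $\mathrm{Tr}[\varrho_\theta\hat q_i]=\theta_i$ for all $\theta$, where $\hat q_i=\int\lambda_i\Pi(\mathrm d\lambda)$. Put $\mathsf R_\theta=\big[\int(\lambda_i-\theta_i)(\lambda_k-\theta_k)\mathrm{Tr}[\varrho_\theta\Pi(\mathrm d\lambda)]\big]$ and $\mathsf Q_\theta=\big[\mathrm{Tr}\,\varrho_\theta(\hat q_i-\theta_i)(\hat q_k-\theta_k)\big]$. Then $$\mathsf R_\theta\ \ge\ \mathsf Q_\theta\ \ge\ \frac{\hbar^2}{4}\,\mathsf S_\theta^{-1}.$$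
   Context: A quantum probability measure (QPM) is a positive-operator-valued measure $\Pi$ on $\mathcal H$ with total mass $\hat 1$, not necessarily projection-valued. $\hbar>0$ is Planck's constant. The parameters being real, the matrix inequality $A\ge B$ is understood in the sense of quadratic forms on real vectors: $\sum_{i,k}(A_{ik}-B_{ik})c_ic_k\ge 0$ for all $c\in\mathbb R^n$. Standing regularity assumptions: the family is smooth, the operators, integrals and traces occurring are well defined and finite, and differentiation with respect to $\theta$ may be interchanged with the trace. *)

theory Defs
  imports "HOL-Analysis.Analysis"
begin

section \<open>Complex Hilbert spaces\<close>

text \<open>The real Hilbert space structure (norm, topology, completeness) is the library's one;
  the complex structure is added on top of it. The inner product is linear in the second argument,
  and the last axiom makes the norm the one of \<open>cinner\<close>. No separability is required.\<close>

class complex_hilbert = real_inner + complete_space +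
  fixes scaleC :: "complex \<Rightarrow> 'a \<Rightarrow> 'a" (infixr "*\<^sub>C" 75)
    and cinner :: "'a \<Rightarrow> 'a \<Rightarrow> complex"
  assumes scaleC_add_right: "a *\<^sub>C (x + y) = a *\<^sub>C x + a *\<^sub>C y"
    and scaleC_add_left: "(a + b) *\<^sub>C x = a *\<^sub>C x + b *\<^sub>C x"
    and scaleC_scaleC: "a *\<^sub>C b *\<^sub>C x = (a * b) *\<^sub>C x"
    and scaleC_of_real: "complex_of_real r *\<^sub>C x = r *\<^sub>R x"
    and cinner_commute: "cinner x y = cnj (cinner y x)"
    and cinner_add_right: "cinner x (y + z) = cinner x y + cinner x z"
    and cinner_scaleC_right: "cinner x (a *\<^sub>C y) = a * cinner x y"
    and Re_cinner: "Re (cinner x y) = inner x y"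

instantiation complex :: complex_hilbert
begin
definition scaleC_complex :: "complex \<Rightarrow> complex \<Rightarrow> complex" where "scaleC_complex a x = a * x"
definition cinner_complex :: "complex \<Rightarrow> complex \<Rightarrow> complex" where "cinner_complex x y = cnj x * y"
instance
  by standard (auto simp: scaleC_complex_def cinner_complex_def algebra_simps scaleR_conv_of_real
      inner_complex_def)
end

definition csubspace :: "'h::complex_hilbert set \<Rightarrow> bool" where
  "csubspace D \<longleftrightarrow> 0 \<in> D \<and> (\<forall>x\<in>D. \<forall>y\<in>D. x + y \<in> D) \<and> (\<forall>a. \<forall>x\<in>D. a *\<^sub>C x \<in> D)"

definition corthonormal :: "'h::complex_hilbert set \<Rightarrow> bool" where
  "corthonormal B \<longleftrightarrow> (\<forall>x\<in>B. \<forall>y\<in>B. cinner x y = (if x = y then 1 else 0))"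

definition conb :: "'h::complex_hilbert set \<Rightarrow> bool" where
  "conb B \<longleftrightarrow> corthonormal B \<and> (\<forall>x. (\<forall>e\<in>B. cinner e x = 0) \<longrightarrow> x = 0)"

section \<open>Bounded operators, trace, density operators\<close>

definition bounded_clinear :: "('h::complex_hilbert \<Rightarrow> 'h) \<Rightarrow> bool" where
  "bounded_clinear T \<longleftrightarrow> bounded_linear T \<and> (\<forall>a x. T (a *\<^sub>C x) = a *\<^sub>C T x)"

definition positive_op :: "('h::complex_hilbert \<Rightarrow> 'h) \<Rightarrow> bool" where
  "positive_op T \<longleftrightarrow> bounded_clinear T \<and> (\<forall>x. cinner x (T x) \<in> \<real>\<^sub>\<ge>\<^sub>0)"

text \<open>A bounded operator is of trace class iff its diagonal is (absolutely) summable in every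
  orthonormal basis; the sum is then the same in all of them and is the trace.\<close>

definition has_trace :: "('h::complex_hilbert \<Rightarrow> 'h) \<Rightarrow> complex \<Rightarrow> bool" where
  "has_trace T t \<longleftrightarrow> bounded_clinear T \<and>
     (\<forall>B. conb B \<longrightarrow> ((\<lambda>e. cinner e (T e)) has_sum t) B)"

definition Tr :: "('h::complex_hilbert \<Rightarrow> 'h) \<Rightarrow> complex" where
  "Tr T = (THE t. has_trace T t)"

definition density_operator :: "('h::complex_hilbert \<Rightarrow> 'h) \<Rightarrow> bool" where
  "density_operator \<rho> \<longleftrightarrow> positive_op \<rho> \<and> has_trace \<rho> 1"

section \<open>Unbounded operators\<close>

text \<open>An operator is a domain together with a map; the values of the map outside the domain are
  irrelevant.\<close>

datatype 'h uop = UOp (udom: "'h set") (uapp: "'h \<Rightarrow> 'h")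

definition hermitian_op :: "'h::complex_hilbert uop \<Rightarrow> bool" where
  "hermitian_op X \<longleftrightarrow> csubspace (udom X) \<and> closure (udom X) = UNIV \<and>
     (\<forall>x\<in>udom X. \<forall>y\<in>udom X. uapp X (x + y) = uapp X x + uapp X y) \<and>
     (\<forall>a. \<forall>x\<in>udom X. uapp X (a *\<^sub>C x) = a *\<^sub>C uapp X x) \<and>
     (\<forall>x\<in>udom X. \<forall>y\<in>udom X. cinner (uapp X x) y = cinner x (uapp X y))"

definition shift_op :: "'h::complex_hilbert uop \<Rightarrow> real \<Rightarrow> 'h uop" where
  "shift_op X a = UOp (udom X) (\<lambda>x. uapp X x - a *\<^sub>R x)"

definition lmult_op :: "('h \<Rightarrow> 'h) \<Rightarrow> 'h uop \<Rightarrow> 'h uop" where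
  "lmult_op T X = UOp (udom X) (\<lambda>x. T (uapp X x))"

text \<open>The trace of a densely defined operator is that of its bounded extension to the whole space,
  which has to exist and to be of trace class.\<close>

definition has_op_trace :: "'h::complex_hilbert uop \<Rightarrow> complex \<Rightarrow> bool" where
  "has_op_trace X t \<longleftrightarrow> closure (udom X) = UNIV \<and>
     (\<exists>T. has_trace T t \<and> (\<forall>x\<in>udom X. T x = uapp X x))"

definition op_Tr :: "'h::complex_hilbert uop \<Rightarrow> complex" where
  "op_Tr X = (THE t. has_op_trace X t)"

section \<open>Second-order moments of unbounded operators\<close>

definition spectral_decomp ::
    "('h::complex_hilbert \<Rightarrow> 'h) \<Rightarrow> 'h set \<Rightarrow> ('h \<Rightarrow> real) \<Rightarrow> bool" where
  "spectral_decomp \<rho> E w \<longleftrightarrow> corthonormal E \<and> (\<forall>e\<in>E. w e > 0) \<and>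
     (\<forall>x. ((\<lambda>e. (of_real (w e) * cinner e x) *\<^sub>C e) has_sum \<rho> x) E)"

text \<open>The trace of \<open>\<rho> X Y\<close>, equivalently of \<open>X Y \<rho>\<close>, for a density operator \<open>\<rho>\<close> and Hermitian
  \<open>X\<close>, \<open>Y\<close>. For unbounded operators the natural domain of the product \<open>X Y\<close> may be too small, so the
  diagonal matrix element of \<open>X Y\<close> at an eigenvector \<open>e\<close> of \<open>\<rho>\<close> is taken as \<open>\<langle>X e, Y e\<rangle>\<close>
  (Holevo's convention for operators square-summable with respect to \<open>\<rho>\<close>). When \<open>X Y \<rho>\<close>
  is everywhere defined and of trace class this is the usual trace, see
  \<open>has_state_trace_if_has_trace\<close> below. A spectral decomposition always exists for a density
  operator; the conjunct saying so only excludes vacuity.\<close>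

definition has_state_trace ::
    "('h::complex_hilbert \<Rightarrow> 'h) \<Rightarrow> 'h uop \<Rightarrow> 'h uop \<Rightarrow> complex \<Rightarrow> bool" where
  "has_state_trace \<rho> X Y t \<longleftrightarrow> (\<exists>E w. spectral_decomp \<rho> E w) \<and>
     (\<forall>E w. spectral_decomp \<rho> E w \<longrightarrow> E \<subseteq> udom X \<inter> udom Y \<and>
        ((\<lambda>e. of_real (w e) * cinner (uapp X e) (uapp Y e)) has_sum t) E)"

definition state_Tr :: "('h::complex_hilbert \<Rightarrow> 'h) \<Rightarrow> 'h uop \<Rightarrow> 'h uop \<Rightarrow> complex" where
  "state_Tr \<rho> X Y = (THE t. has_state_trace \<rho> X Y t)"

lemma scaleC_zero_left: "0 *\<^sub>C x = (0::'h::complex_hilbert)"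
  using scaleC_of_real[of 0 x] by simp

lemma hermitian_op_zero:
  assumes "hermitian_op X"
  shows "uapp X 0 = 0"
proof -
  have "uapp X (0 *\<^sub>C 0) = 0 *\<^sub>C uapp X 0"
    using assms unfolding hermitian_op_def csubspace_def by blast
  then show ?thesis by (simp add: scaleC_zero_left)
qed

lemma corthonormal_extends_conb:
  fixes E :: "'h::complex_hilbert set"
  assumes "corthonormal E"
  obtains B where "E \<subseteq> B" "conb B"
proof -
  let ?A = "{B. E \<subseteq> B \<and> corthonormal B}"
  have "\<exists>M\<in>?A. \<forall>X\<in>?A. M \<subseteq> X \<longrightarrow> X = M"
  proof (rule subset_Zorn_nonempty)
    show "?A \<noteq> {}" using assms by auto
    fix C assume C: "C \<noteq> {}" "subset.chain ?A C"
    have "corthonormal (\<Union>C)" unfolding corthonormal_def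
    proof (intro ballI)
      fix x y assume "x \<in> \<Union>C" "y \<in> \<Union>C"
      then obtain X Y where X: "X \<in> C" "x \<in> X" and Y: "Y \<in> C" "y \<in> Y" by auto
      have "X \<subseteq> Y \<or> Y \<subseteq> X" using subset.chain_total[OF C(2) X(1) Y(1)] by auto
      then obtain Z where "Z \<in> C" "x \<in> Z" "y \<in> Z" using X Y by auto
      moreover have "corthonormal Z" using C \<open>Z \<in> C\<close> by (auto simp: subset.chain_def)
      ultimately show "cinner x y = (if x = y then 1 else 0)" unfolding corthonormal_def by blast
    qed
    moreover have "E \<subseteq> \<Union>C" using C by (fastforce simp: subset.chain_def)
    ultimately show "\<Union>C \<in> ?A" by auto
  qed
  then obtain M where M: "E \<subseteq> M" "corthonormal M"
    and max: "\<And>X. E \<subseteq> X \<Longrightarrow> corthonormal X \<Longrightarrow> M \<subseteq> X \<Longrightarrow> X = M" by auto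
  have "x = 0" if x: "\<forall>e\<in>M. cinner e x = 0" for x
  proof (rule ccontr)
    assume nz: "x \<noteq> 0"
    have xx: "cinner x x = of_real ((norm x)\<^sup>2)"
    proof (rule complex_eqI)
      have "cinner x x = cnj (cinner x x)" by (rule cinner_commute)
      from arg_cong[OF this, of Im] show "Im (cinner x x) = Im (of_real ((norm x)\<^sup>2))" by simp
    qed (simp add: Re_cinner power2_norm_eq_inner)
    define u where "u = of_real (1 / norm x) *\<^sub>C x"
    have ux: "cinner u x = of_real (1 / norm x) * cinner x x"
      using cinner_commute[of u x] cinner_commute[of x x]
      by (simp add: u_def cinner_scaleC_right xx)
    have uu: "cinner u u = 1"
    proof -
      have "cinner u u = of_real (1 / norm x) * cinner u x"
        by (subst (2) u_def) (simp add: cinner_scaleC_right)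
      also have "\<dots> = 1" unfolding ux xx using nz by (simp add: power2_eq_square)
      finally show ?thesis .
    qed
    have eu: "cinner e u = 0" if "e \<in> M" for e using x that by (simp add: u_def cinner_scaleC_right)
    have ue: "cinner u e = 0" if "e \<in> M" for e using eu[OF that] cinner_commute[of u e] by simp
    have "corthonormal (insert u M)"
      using M(2) uu eu ue unfolding corthonormal_def by auto
    then have "insert u M = M" using max[of "insert u M"] M(1) by auto
    then have "u \<in> M" by auto
    then show False using eu uu by auto
  qed
  then show ?thesis using that M unfolding conb_def by blast
qed

lemma spectral_decomp_eigen:
  assumes "spectral_decomp \<rho> E w" "e \<in> E"
  shows "\<rho> e = of_real (w e) *\<^sub>C e"
proof -
  let ?f = "\<lambda>d. (of_real (w d) * cinner d e) *\<^sub>C d"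
  have "(?f has_sum \<rho> e) E" using assms unfolding spectral_decomp_def by blast
  moreover have "(?f has_sum \<rho> e) E \<longleftrightarrow> (?f has_sum \<rho> e) {e}"
    using assms by (intro has_sum_cong_neutral)
      (auto simp: spectral_decomp_def corthonormal_def scaleC_zero_left)
  ultimately have "\<rho> e = ?f e" using has_sum_unique[OF _ has_sum_finite[of "{e}" ?f]] by auto
  moreover have "cinner e e = 1" using assms by (auto simp: spectral_decomp_def corthonormal_def)
  ultimately show ?thesis by simp
qed

lemma has_state_trace_if_has_trace:
  fixes \<rho> :: "'h::complex_hilbert \<Rightarrow> 'h"
  assumes "\<exists>E w. spectral_decomp \<rho> E w" and X: "hermitian_op X" and Y: "hermitian_op Y"
    and dom: "\<And>x. \<rho> x \<in> udom X" "\<And>x. \<rho> x \<in> udom Y" "\<And>x. uapp Y (\<rho> x) \<in> udom X"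
    and tr: "has_trace (\<lambda>x. uapp X (uapp Y (\<rho> x))) t"
  shows "has_state_trace \<rho> X Y t"
  unfolding has_state_trace_def
proof (intro conjI allI impI)
  fix E w assume sd: "spectral_decomp \<rho> E w"
  have pos: "w e > 0" if "e \<in> E" for e using sd that by (auto simp: spectral_decomp_def)
  have e_eq: "e = of_real (1 / w e) *\<^sub>C \<rho> e" if "e \<in> E" for e
    using pos[OF that] by (simp add: spectral_decomp_eigen[OF sd that] scaleC_scaleC)
      (metis of_real_1 scaleC_of_real scaleR_one)
  have dX: "e \<in> udom X" and dY: "e \<in> udom Y" if "e \<in> E" for e
  proof -
    have "csubspace (udom X)" "csubspace (udom Y)" using X Y unfolding hermitian_op_def by auto
    then have "of_real (1 / w e) *\<^sub>C \<rho> e \<in> udom X" "of_real (1 / w e) *\<^sub>C \<rho> e \<in> udom Y"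
      using dom(1,2) unfolding csubspace_def by auto
    then show "e \<in> udom X" "e \<in> udom Y" using e_eq[OF that] by simp_all
  qed
  show "E \<subseteq> udom X \<inter> udom Y" using dX dY by auto
  have el: "cinner e (uapp X (uapp Y (\<rho> e))) = of_real (w e) * cinner (uapp X e) (uapp Y e)"
    if "e \<in> E" for e
  proof -
    have "uapp Y (\<rho> e) = of_real (w e) *\<^sub>C uapp Y e"
      using Y dY[OF that] unfolding hermitian_op_def spectral_decomp_eigen[OF sd that] by blast
    moreover have "cinner e (uapp X (uapp Y (\<rho> e))) = cinner (uapp X e) (uapp Y (\<rho> e))"
      using X dX[OF that] dom(3)[of e] unfolding hermitian_op_def by simp
    ultimately show ?thesis by (simp only: cinner_scaleC_right)
  qed
  obtain B where B: "E \<subseteq> B" "conb B"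
    using corthonormal_extends_conb sd unfolding spectral_decomp_def by blast
  have zero: "uapp X (uapp Y (\<rho> b)) = 0" if "b \<in> B - E" for b
  proof -
    have "((\<lambda>e. (of_real (w e) * cinner e b) *\<^sub>C e) has_sum \<rho> b) E"
      using sd unfolding spectral_decomp_def by blast
    moreover have "cinner e b = 0" if "e \<in> E" for e
      using B that \<open>b \<in> B - E\<close> unfolding conb_def corthonormal_def by auto
    ultimately have "((\<lambda>e. 0) has_sum \<rho> b) E"
      by (auto simp: scaleC_zero_left cong: has_sum_cong)
    then have "\<rho> b = 0" by (rule has_sum_unique) (simp add: has_sum_0)
    moreover have "uapp Y 0 = 0" and "uapp X 0 = 0"
      using X Y hermitian_op_zero by auto
    ultimately show ?thesis by simp
  qed
  have "((\<lambda>e. cinner e (uapp X (uapp Y (\<rho> e)))) has_sum t) B"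
    using tr B unfolding has_trace_def by blast
  moreover have "((\<lambda>e. cinner e (uapp X (uapp Y (\<rho> e)))) has_sum t) B \<longleftrightarrow>
      ((\<lambda>e. of_real (w e) * cinner (uapp X e) (uapp Y e)) has_sum t) E"
    using B(1) zero el cinner_scaleC_right[of _ 0 0]
    by (intro has_sum_cong_neutral) (auto simp: scaleC_zero_left)
  ultimately show "((\<lambda>e. of_real (w e) * cinner (uapp X e) (uapp Y e)) has_sum t) E" by simp
qed (use assms in auto)

section \<open>Quantum probability measures\<close>

definition quantum_prob_measure ::
    "((real^'n) set \<Rightarrow> 'h::complex_hilbert \<Rightarrow> 'h) \<Rightarrow> bool" where
  "quantum_prob_measure M \<longleftrightarrow> (\<forall>A\<in>sets borel. positive_op (M A)) \<and> M UNIV = id \<and>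
     (\<forall>A :: nat \<Rightarrow> (real^'n) set. range A \<subseteq> sets borel \<longrightarrow> disjoint_family A \<longrightarrow>
        (\<forall>x. (\<lambda>j. M (A j) x) sums M (\<Union>j. A j) x))"

definition diag_measure ::
    "((real^'n) set \<Rightarrow> 'h::complex_hilbert \<Rightarrow> 'h) \<Rightarrow> 'h \<Rightarrow> (real^'n) measure" where
  "diag_measure M x = measure_of UNIV (sets borel) (\<lambda>A. ennreal (Re (cinner x (M A x))))"

definition outcome_measure ::
    "((real^'n) set \<Rightarrow> 'h::complex_hilbert \<Rightarrow> 'h) \<Rightarrow> ('h \<Rightarrow> 'h) \<Rightarrow> (real^'n) measure" where
  "outcome_measure M \<rho> = measure_of UNIV (sets borel) (\<lambda>A. ennreal (Re (Tr (\<rho> \<circ> M A))))"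

text \<open>\<open>X\<close> is the integral of the real function \<open>f\<close> with respect to \<open>M\<close>: its domain consists of all
  \<open>x\<close> for which \<open>f\<close> is square-integrable with respect to \<open>\<langle>x, M(\<cdot>) x\<rangle>\<close>, and there \<open>X\<close> is
  determined by its quadratic form (through polarization). That the domain is dense is part of
  the integral being well defined.\<close>

definition is_qpm_integral ::
    "((real^'n) set \<Rightarrow> 'h::complex_hilbert \<Rightarrow> 'h) \<Rightarrow> (real^'n \<Rightarrow> real) \<Rightarrow> 'h uop \<Rightarrow> bool" where
  "is_qpm_integral M f X \<longleftrightarrow> hermitian_op X \<and>
     udom X = {x. integrable (diag_measure M x) (\<lambda>l. (f l)\<^sup>2)} \<and>
     (\<forall>x\<in>udom X. cinner x (uapp X x) = of_real (\<integral>l. f l \<partial>diag_measure M x))"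

section \<open>Smooth families\<close>

primrec Ck_on :: "nat \<Rightarrow> (real^'n) set \<Rightarrow> (real^'n \<Rightarrow> 'b::real_normed_vector) \<Rightarrow> bool" where
  "Ck_on 0 S f \<longleftrightarrow> continuous_on S f"
| "Ck_on (Suc m) S f \<longleftrightarrow> (\<exists>f'. \<forall>i.
     (\<forall>x\<in>S. ((\<lambda>t. f (x + t *\<^sub>R axis i 1)) has_vector_derivative f' i x) (at 0)) \<and> Ck_on m S (f' i))"

text \<open>Smoothness and the partial derivatives are taken in the strong operator topology.\<close>

definition smooth_family :: "(real^'n) set \<Rightarrow> (real^'n \<Rightarrow> 'h::complex_hilbert \<Rightarrow> 'h) \<Rightarrow> bool" where
  "smooth_family S \<rho> \<longleftrightarrow> (\<forall>x m. Ck_on m S (\<lambda>\<theta>. \<rho> \<theta> x))"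

definition partial_op ::
    "'n \<Rightarrow> (real^'n \<Rightarrow> 'h::complex_hilbert \<Rightarrow> 'h) \<Rightarrow> real^'n \<Rightarrow> 'h \<Rightarrow> 'h" where
  "partial_op k \<rho> \<theta> x = vector_derivative (\<lambda>t. \<rho> (\<theta> + t *\<^sub>R axis k 1) x) (at 0)"

section \<open>The three matrices and their ordering\<close>

definition S_matrix ::
    "('h::complex_hilbert \<Rightarrow> 'h) \<Rightarrow> ('n \<Rightarrow> 'h uop) \<Rightarrow> complex^'n^'n" where
  "S_matrix \<rho> p = (\<chi> i k. (state_Tr \<rho> (p i) (p k) + state_Tr \<rho> (p k) (p i)) / 2)"

definition R_matrix ::
    "('h::complex_hilbert \<Rightarrow> 'h) \<Rightarrow> ((real^'n) set \<Rightarrow> 'h \<Rightarrow> 'h) \<Rightarrow> real^'n \<Rightarrow> complex^'n^'n" where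
  "R_matrix \<rho> M \<theta> =
     (\<chi> i k. of_real (\<integral>l. (l $ i - \<theta> $ i) * (l $ k - \<theta> $ k) \<partial>outcome_measure M \<rho>))"

definition Q_matrix ::
    "('h::complex_hilbert \<Rightarrow> 'h) \<Rightarrow> ('n \<Rightarrow> 'h uop) \<Rightarrow> real^'n \<Rightarrow> complex^'n^'n" where
  "Q_matrix \<rho> q \<theta> = (\<chi> i k. state_Tr \<rho> (shift_op (q i) (\<theta> $ i)) (shift_op (q k) (\<theta> $ k)))"

text \<open>The entries may be complex, the test vectors are real; the form has to be real and
  nonnegative.\<close>

definition matrix_ge :: "complex^'n^'n \<Rightarrow> complex^'n^'n \<Rightarrow> bool" where
  "matrix_ge A B \<longleftrightarrow> (\<forall>c :: real^'n.
     (\<Sum>i\<in>UNIV. \<Sum>k\<in>UNIV. (A $ i $ k - B $ i $ k) * of_real (c $ i) * of_real (c $ k)) \<in> \<real>\<^sub>\<ge>\<^sub>0)"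

end

(* Fix \<theta> and an eigenbasis E of \<rho> = \<Sum> w_e |e><e|; put v_i = (q_i - \<theta>_i) e and Y = \<Sum> d_k p_k e.

   R \<ge> Q: for an operator-valued step integral T = \<Sum>_v \<phi>(v) M(A_v) over a finite partition, positivity of
   \<Sum>_v <\<phi>(v) x - T x, M(A_v) (\<phi>(v) x - T x)> gives |T x|^2 \<le> \<integral> \<phi>^2 d<x, M x>. Step integrals converge
   weakly to q_i - \<theta>_i (polarization on the dense domain, then uniform boundedness), and summing over
   finitely many eigenvectors passes the bound to the outcome distribution.

   Q \<ge> (hbar^2/4) S^-1: differentiating Tr (\<rho> q_i) = \<theta>_i and inserting the commutator equation gives
   \<Sum>_e w_e Im <p_k e, v_i> = -(hbar/2) \<delta>_ik. For real c, S d = c and Z = \<Sum> c_i v_i, summing the pointwise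
   inequality |Z|^2 + hbar Im <Y, Z> + (hbar^2/4) |Y|^2 \<ge> 0 yields the bound. *)

theory Submission
  imports Defs
begin

section \<open>The complex inner product\<close>

text \<open>The obstacle is domains. The commutator equation is given on the domain of p_k only and
  the trace of \<rho> q_i only through a bounded extension, while neither q_i u in dom p_k nor p_k e
  in dom q_i is available; cyclic permutation under the trace cannot be used directly. Everything is
  therefore carried by sums of rank-one operators |w_e e><p_k e| and |p_k e><w_e q_i e|, which are
  trace class because the weights and the second moments S and Q are summable. In this form the
  commutator equation extends to all vectors. The 1/2 in -(hbar/2) \<delta>_ik arises because the
  two traces of the commutator are complex conjugates, so that their difference is 2i times one
  imaginary part. With S d = c, both the cross term and the |Y|^2 term are multiples of c.d, and
  -hbar^2/2 + hbar^2/4 leaves the constant of the theorem. For a measure that is not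
  projection-valued the second moment only dominates the squared norm; the positivity argument on
  finite partitions takes the place of a Naimark dilation. Weak convergence then suffices, since the
  norm is weakly lower semicontinuous.\<close>

instance complex_hilbert \<subseteq> banach ..

lemma cinner_add_left: "cinner (x + y) z = cinner x z + cinner (y::'h::complex_hilbert) z"
  by (metis cinner_add_right cinner_commute complex_cnj_add)

lemma cinner_scaleC_left: "cinner (a *\<^sub>C x) y = cnj a * cinner (x::'h::complex_hilbert) y"
  by (metis cinner_commute cinner_scaleC_right complex_cnj_mult)

lemma cinner_scaleR_right: "cinner x (r *\<^sub>R y) = of_real r * cinner (x::'h::complex_hilbert) y"
  by (metis cinner_scaleC_right scaleC_of_real)

lemma cinner_scaleR_left: "cinner (r *\<^sub>R x) y = of_real r * cinner (x::'h::complex_hilbert) y"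
  by (metis cinner_scaleC_left complex_cnj_complex_of_real scaleC_of_real)

lemma cinner_zero_right [simp]: "cinner (x::'h::complex_hilbert) 0 = 0"
  using cinner_scaleR_right[of x 0 0] by simp

lemma cinner_zero_left [simp]: "cinner 0 (x::'h::complex_hilbert) = 0"
  using cinner_scaleR_left[of 0 0 x] by simp

lemma cinner_minus_right: "cinner x (- y) = - cinner (x::'h::complex_hilbert) y"
  using cinner_scaleR_right[of x "-1" y] by simp

lemma cinner_minus_left: "cinner (- x) y = - cinner (x::'h::complex_hilbert) y"
  using cinner_scaleR_left[of "-1" x y] by simp

lemma cinner_diff_right: "cinner x (y - z) = cinner x y - cinner (x::'h::complex_hilbert) z"
  using cinner_add_right[of x y "-z"] by (simp add: cinner_minus_right)

lemma cinner_diff_left: "cinner (x - y) z = cinner x z - cinner (y::'h::complex_hilbert) z"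
  using cinner_add_left[of x "-y" z] by (simp add: cinner_minus_left)

lemma cinner_sum_right: "cinner x (\<Sum>i\<in>A. f i) = (\<Sum>i\<in>A. cinner (x::'h::complex_hilbert) (f i))"
  by (induction A rule: infinite_finite_induct) (auto simp: cinner_add_right)

lemma cinner_sum_left: "cinner (\<Sum>i\<in>A. f i) x = (\<Sum>i\<in>A. cinner (f i) (x::'h::complex_hilbert))"
  by (induction A rule: infinite_finite_induct) (auto simp: cinner_add_left)

lemma cinner_self: "cinner x x = of_real ((norm (x::'h::complex_hilbert))\<^sup>2)"
proof (rule complex_eqI)
  have "cinner x x = cnj (cinner x x)" by (rule cinner_commute)
  from arg_cong[OF this, of Im] show "Im (cinner x x) = Im (of_real ((norm x)\<^sup>2))" by simp
qed (simp add: Re_cinner power2_norm_eq_inner)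

lemma norm_scaleC: "norm (a *\<^sub>C x) = norm a * norm (x::'h::complex_hilbert)"
proof -
  have "complex_of_real ((norm (a *\<^sub>C x))\<^sup>2) = a * cnj a * of_real ((norm x)\<^sup>2)"
    using cinner_self[of "a *\<^sub>C x"] cinner_self[of x]
    by (metis cinner_scaleC_left cinner_scaleC_right mult.assoc mult.left_commute)
  also have "\<dots> = of_real ((norm a * norm x)\<^sup>2)"
    by (metis complex_norm_square power_mult_distrib of_real_mult)
  finally have "(norm (a *\<^sub>C x))\<^sup>2 = (norm a * norm x)\<^sup>2" by (simp only: of_real_eq_iff)
  then show ?thesis by (simp add: power2_eq_iff_nonneg)
qed

lemma cinner_Cauchy_Schwarz: "norm (cinner x y) \<le> norm x * norm (y::'h::complex_hilbert)"
proof (cases "cinner x y = 0")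
  case False
  let ?c = "cinner x y"
  \<comment> \<open>A unit phase that turns the inner product into its modulus; the real
    Cauchy-Schwarz inequality then applies.\<close>
  let ?a = "cnj ?c / of_real (norm ?c)"
  have "cinner x (?a *\<^sub>C y) = of_real (norm ?c)"
    using False by (simp add: cinner_scaleC_right complex_norm_square[symmetric] power2_eq_square
        mult.commute[of "cnj _"])
  then have "norm ?c = inner x (?a *\<^sub>C y)" by (metis Re_cinner Re_complex_of_real)
  also have "\<dots> \<le> norm x * norm (?a *\<^sub>C y)" by (rule norm_cauchy_schwarz)
  also have "norm (?a *\<^sub>C y) = norm y" using False by (simp add: norm_scaleC norm_divide)
  finally show ?thesis .
qed auto

lemma bounded_linear_cinner_right: "bounded_linear (cinner (x::'h::complex_hilbert))"
  by (rule bounded_linear_intro[where K = "norm x"])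
     (auto simp: cinner_add_right cinner_scaleR_right scaleR_conv_of_real
        intro: order_trans[OF cinner_Cauchy_Schwarz] simp: mult.commute)

lemma bounded_linear_cinner_left: "bounded_linear (\<lambda>x. cinner x (y::'h::complex_hilbert))"
  by (rule bounded_linear_intro[where K = "norm y"])
     (auto simp: cinner_add_left cinner_scaleR_left scaleR_conv_of_real
        intro: order_trans[OF cinner_Cauchy_Schwarz])

lemma scaleC_scaleR_commute: "a *\<^sub>C r *\<^sub>R x = r *\<^sub>R a *\<^sub>C (x::'h::complex_hilbert)"
  by (metis mult.commute scaleC_of_real scaleC_scaleC)

lemma bounded_linear_scaleC_right: "bounded_linear (\<lambda>x::'h::complex_hilbert. a *\<^sub>C x)"
  by (rule bounded_linear_intro[where K = "norm a"])
     (auto simp: scaleC_add_right scaleC_scaleR_commute norm_scaleC)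

lemma scaleC_one: "1 *\<^sub>C x = (x::'h::complex_hilbert)"
  using scaleC_of_real[of 1 x] by simp

section \<open>Orthonormal bases\<close>

lemma corthonormal_norm_sum:
  fixes F :: "'h::complex_hilbert set"
  assumes "corthonormal F" "finite F"
  shows "(norm (\<Sum>e\<in>F. c e *\<^sub>C e))\<^sup>2 = (\<Sum>e\<in>F. (norm (c e))\<^sup>2)"
proof -
  have "cinner (\<Sum>e\<in>F. c e *\<^sub>C e) (\<Sum>e\<in>F. c e *\<^sub>C e)
      = (\<Sum>d\<in>F. \<Sum>e\<in>F. cnj (c d) * c e * cinner d e)"
    unfolding cinner_sum_left unfolding cinner_sum_right cinner_scaleC_left cinner_scaleC_right
    by (intro sum.cong refl) (simp add: mult_ac)
  also have "\<dots> = (\<Sum>d\<in>F. \<Sum>e\<in>F. if d = e then cnj (c d) * c e else 0)"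
    using assms(1) unfolding corthonormal_def by (intro sum.cong refl) auto
  also have "\<dots> = (\<Sum>d\<in>F. of_real ((norm (c d))\<^sup>2))"
    using assms(2) by (simp add: complex_norm_square mult.commute del: of_real_power)
  finally have "complex_of_real ((norm (\<Sum>e\<in>F. c e *\<^sub>C e))\<^sup>2) = of_real (\<Sum>e\<in>F. (norm (c e))\<^sup>2)"
    by (simp only: cinner_self of_real_sum)
  then show ?thesis by (simp only: of_real_eq_iff)
qed

lemma Bessel_inequality:
  fixes F :: "'h::complex_hilbert set"
  assumes "corthonormal F" "finite F"
  shows "(\<Sum>e\<in>F. (norm (cinner e x))\<^sup>2) \<le> (norm x)\<^sup>2"
proof -
  let ?s = "\<Sum>e\<in>F. cinner e x *\<^sub>C e"
  have "cinner ?s x = of_real (\<Sum>e\<in>F. (norm (cinner e x))\<^sup>2)"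
    by (simp add: cinner_sum_left cinner_scaleC_left complex_norm_square mult.commute
        del: of_real_power)
  then have "(\<Sum>e\<in>F. (norm (cinner e x))\<^sup>2) = inner ?s x" by (metis Re_cinner Re_complex_of_real)
  moreover have "(norm ?s)\<^sup>2 = (\<Sum>e\<in>F. (norm (cinner e x))\<^sup>2)"
    by (rule corthonormal_norm_sum[OF assms])
  moreover have "0 \<le> (norm (x - ?s))\<^sup>2" by simp
  moreover have "(norm (x - ?s))\<^sup>2 = (norm x)\<^sup>2 - 2 * inner ?s x + (norm ?s)\<^sup>2"
    unfolding power2_norm_eq_inner by (simp add: inner_diff_left inner_diff_right inner_commute)
  ultimately show ?thesis by linarith
qed

lemma corthonormal_subset: "corthonormal B \<Longrightarrow> F \<subseteq> B \<Longrightarrow> corthonormal F"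
  unfolding corthonormal_def by blast

lemma Bessel_summable:
  assumes "corthonormal B"
  shows "(\<lambda>e. (norm (cinner e x))\<^sup>2) summable_on B"
  using Bessel_inequality corthonormal_subset[OF assms]
  by (intro nonneg_bdd_above_summable_on) (auto intro!: bdd_aboveI2[where M = "(norm x)\<^sup>2"])

text \<open>The index set may be uncountable, so the Cauchy property is shown for the net of finite
  subsets. By orthonormality the squared distance of two nested partial sums is a piece of the
  convergent Bessel series, and completeness supplies the limit.\<close>

lemma Bessel_vector_summable:
  fixes B :: "'h::complex_hilbert set"
  assumes B: "corthonormal B"
  shows "(\<lambda>e. cinner e y *\<^sub>C e) summable_on B"
proof -
  let ?f = "\<lambda>e. cinner e y *\<^sub>C e" and ?n = "\<lambda>e. (norm (cinner e y))\<^sup>2"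
  obtain s where s: "(?n has_sum s) B" using Bessel_summable[OF B] unfolding summable_on_def by blast
  have "\<exists>P. eventually P (finite_subsets_at_top B) \<and>
      (\<forall>F F'. P F \<and> P F' \<longrightarrow> dist (sum ?f F) (sum ?f F') < \<epsilon>)" if "\<epsilon> > 0" for \<epsilon>
  proof -
    \<comment> \<open>Two partial sums are compared through \<open>F0\<close>, each at distance at
      most \<epsilon>/3 from it; 2\<epsilon>/3 leaves room for the strict inequality.\<close>
    have "0 < (\<epsilon> / 3)\<^sup>2" using that by simp
    from has_sum_finite_approximation[OF s this]
    obtain F0 where F0: "finite F0" "F0 \<subseteq> B" "dist (sum ?n F0) s \<le> (\<epsilon> / 3)\<^sup>2" by blast
    let ?P = "\<lambda>F. finite F \<and> F0 \<subseteq> F \<and> F \<subseteq> B"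
    have near: "dist (sum ?f F) (sum ?f F0) \<le> \<epsilon> / 3" if F: "?P F" for F
    proof -
      have "sum ?f F - sum ?f F0 = sum ?f (F - F0)" using F by (subst sum_diff) auto
      then have "(dist (sum ?f F) (sum ?f F0))\<^sup>2 = sum ?n (F - F0)"
        unfolding dist_norm using F corthonormal_subset[OF B, of "F - F0"]
        by (simp add: corthonormal_norm_sum Diff_subset subset_trans[OF Diff_subset])
      also have "\<dots> = sum ?n F - sum ?n F0" using F by (subst sum_diff) auto
      also have "\<dots> \<le> s - sum ?n F0"
        using finite_sum_le_has_sum[OF s, of F] F by auto
      also have "\<dots> \<le> (\<epsilon> / 3)\<^sup>2" using F0(3) unfolding dist_real_def by linarith
      finally show ?thesis using \<open>\<epsilon> > 0\<close> by (simp add: power2_le_iff_abs_le)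
    qed
    have "dist (sum ?f F) (sum ?f F') < \<epsilon>" if "?P F" "?P F'" for F F'
      using near[OF that(1)] near[OF that(2)] dist_triangle2[of "sum ?f F" "sum ?f F'" "sum ?f F0"]
        \<open>\<epsilon> > 0\<close> by linarith
    moreover have "eventually ?P (finite_subsets_at_top B)"
      using F0 unfolding eventually_finite_subsets_at_top by metis
    ultimately show ?thesis by (intro exI[of _ ?P] conjI allI impI) simp_all
  qed
  then have "cauchy_filter (filtermap (sum ?f) (finite_subsets_at_top B))"
    by (simp add: cauchy_filter_metric_filtermap)
  moreover have "complete (UNIV :: 'h set)"
    by (meson Cauchy_convergent UNIV_I complete_def convergent_def)
  ultimately obtain L where "(sum ?f \<longlongrightarrow> L) (finite_subsets_at_top B)"
    using complete_uniform[where S = UNIV] by (force simp: filterlim_def)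
  then show ?thesis unfolding summable_on_def has_sum_def by blast
qed

text \<open>The sum exists by Bessel, and its difference from y is orthogonal to every basis vector;
  \<open>conb\<close> says that such a vector vanishes.\<close>

lemma conb_expansion:
  fixes B :: "'h::complex_hilbert set"
  assumes B: "conb B"
  shows "((\<lambda>e. cinner e y *\<^sub>C e) has_sum y) B"
proof -
  have on: "corthonormal B" using B unfolding conb_def by blast
  obtain z where z: "((\<lambda>e. cinner e y *\<^sub>C e) has_sum z) B"
    using Bessel_vector_summable[OF on] unfolding summable_on_def by blast
  have "cinner d (y - z) = 0" if d: "d \<in> B" for d
  proof -
    have "((\<lambda>e. cinner d (cinner e y *\<^sub>C e)) has_sum cinner d z) B"
      by (rule has_sum_bounded_linear[OF bounded_linear_cinner_right z])
    moreover have "((\<lambda>e. cinner d (cinner e y *\<^sub>C e)) has_sum cinner d y) B"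
      using d on by (intro has_sum_finite_neutralI[of "{d}"])
        (auto simp: cinner_scaleC_right corthonormal_def)
    ultimately show ?thesis using has_sum_unique by (fastforce simp: cinner_diff_right)
  qed
  then have "y - z = 0" using B unfolding conb_def by blast
  then show ?thesis using z by simp
qed

lemma Parseval:
  fixes B :: "'h::complex_hilbert set"
  assumes "conb B"
  shows "((\<lambda>e. cinner x e * cinner e y) has_sum cinner x y) B"
  using has_sum_bounded_linear[OF bounded_linear_cinner_right conb_expansion[OF assms, of y], of x]
  by (simp add: cinner_scaleC_right mult.commute)

lemma norm_cinner_commute: "norm (cinner x y) = norm (cinner y (x::'h::complex_hilbert))"
  by (metis cinner_commute complex_mod_cnj)

text \<open>Cauchy-Schwarz in l2 over the finite set, followed by Bessel for each factor. The bound
  does not depend on F, which is what yields absolute summability over the basis.\<close>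

lemma Bessel_product_sum:
  fixes B :: "'h::complex_hilbert set"
  assumes B: "corthonormal B" and F: "F \<subseteq> B" "finite F"
  shows "(\<Sum>e\<in>F. norm (cinner x e * cinner e y)) \<le> norm x * norm y"
proof -
  have b: "L2_set (\<lambda>e. norm (cinner e z)) F \<le> norm z" for z
    using Bessel_inequality[OF corthonormal_subset[OF B F(1)] F(2), of z]
    unfolding L2_set_def by (simp add: real_le_lsqrt sum_nonneg)
  have "(\<Sum>e\<in>F. norm (cinner x e * cinner e y)) = (\<Sum>e\<in>F. \<bar>norm (cinner e x)\<bar> * \<bar>norm (cinner e y)\<bar>)"
    by (simp add: norm_mult norm_cinner_commute[of x])
  also have "\<dots> \<le> L2_set (\<lambda>e. norm (cinner e x)) F * L2_set (\<lambda>e. norm (cinner e y)) F"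
    by (rule L2_set_mult_ineq)
  also have "\<dots> \<le> norm x * norm y" by (intro mult_mono b) (auto simp: L2_set_nonneg)
  finally show ?thesis .
qed

lemma Bessel_product_summable:
  fixes B :: "'h::complex_hilbert set"
  assumes B: "corthonormal B"
  shows "(\<lambda>e. norm (cinner x e * cinner e y)) summable_on B"
    and "(\<Sum>\<^sub>\<infinity>e\<in>B. norm (cinner x e * cinner e y)) \<le> norm x * norm y"
proof -
  show *: "(\<lambda>e. norm (cinner x e * cinner e y)) summable_on B"
    using Bessel_product_sum[OF B]
    by (intro nonneg_bdd_above_summable_on) (auto intro!: bdd_aboveI2[where M = "norm x * norm y"])
  show "(\<Sum>\<^sub>\<infinity>e\<in>B. norm (cinner x e * cinner e y)) \<le> norm x * norm y"
    by (rule infsum_le_finite_sums[OF *]) (rule Bessel_product_sum[OF B])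
qed

section \<open>Traces\<close>

lemma conb_exists: obtains B :: "'h::complex_hilbert set" where "conb B"
  using corthonormal_extends_conb[of "{}"] unfolding corthonormal_def by auto

lemma has_trace_unique: "has_trace T s \<Longrightarrow> has_trace T t \<Longrightarrow> s = t"
  unfolding has_trace_def by (rule conb_exists) (auto intro: has_sum_unique)

lemma Tr_eq: "has_trace T t \<Longrightarrow> Tr T = t"
  unfolding Tr_def by (rule the_equality) (assumption, erule (1) has_trace_unique)

lemma bounded_clinear_eq_on_dense:
  assumes "bounded_clinear S" "bounded_clinear T" "closure D = UNIV" "\<And>x. x \<in> D \<Longrightarrow> S x = T x"
  shows "S = T"
proof
  fix x :: 'a
  have "x \<in> closure D" using assms by auto
  then obtain f where f: "\<And>n. f n \<in> D" "f \<longlonglongrightarrow> x" unfolding closure_sequential by blast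
  have "(\<lambda>n. S (f n)) \<longlonglongrightarrow> S x" "(\<lambda>n. T (f n)) \<longlonglongrightarrow> T x"
    using assms(1,2) bounded_linear.tendsto[OF _ f(2)] unfolding bounded_clinear_def by blast+
  then show "S x = T x" using assms(4)[OF f(1)] LIMSEQ_unique by fastforce
qed

lemma has_op_trace_unique:
  assumes "has_op_trace X s" "has_op_trace X t"
  shows "s = t"
proof -
  obtain S T where "has_trace S s" "has_trace T t" "closure (udom X) = UNIV"
      "\<And>x. x \<in> udom X \<Longrightarrow> S x = uapp X x" "\<And>x. x \<in> udom X \<Longrightarrow> T x = uapp X x"
    using assms unfolding has_op_trace_def by blast
  moreover from this have "S = T"
    by (intro bounded_clinear_eq_on_dense[of S T "udom X"]) (auto simp: has_trace_def)
  ultimately show ?thesis using has_trace_unique by blast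
qed

lemma op_Tr_eq: "has_op_trace X t \<Longrightarrow> op_Tr X = t"
  unfolding op_Tr_def by (rule the_equality) (assumption, erule (1) has_op_trace_unique)

lemma has_state_trace_unique: "has_state_trace \<rho> X Y s \<Longrightarrow> has_state_trace \<rho> X Y t \<Longrightarrow> s = t"
proof -
  assume s: "has_state_trace \<rho> X Y s" and t: "has_state_trace \<rho> X Y t"
  obtain E w where E: "spectral_decomp \<rho> E w" using s unfolding has_state_trace_def by (elim conjE exE)
  have "((\<lambda>e. of_real (w e) * cinner (uapp X e) (uapp Y e)) has_sum s) E"
    using s E unfolding has_state_trace_def by simp
  moreover have "((\<lambda>e. of_real (w e) * cinner (uapp X e) (uapp Y e)) has_sum t) E"
    using t E unfolding has_state_trace_def by simp
  ultimately show "s = t" by (rule has_sum_unique)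
qed

lemma state_Tr_eq: "has_state_trace \<rho> X Y t \<Longrightarrow> state_Tr \<rho> X Y = t"
  unfolding state_Tr_def by (rule the_equality) (assumption, erule (1) has_state_trace_unique)

text \<open>The operator \<Sum> |a_i><b_i|, a form in which the trace condition can be verified for
  all orthonormal bases at once. Where the series is not summable \<open>infsum\<close> returns 0,
  so the lemmas below carry summability of the products of norms.\<close>

definition rank_one_sum :: "'i set \<Rightarrow> ('i \<Rightarrow> 'h) \<Rightarrow> ('i \<Rightarrow> 'h) \<Rightarrow> 'h::complex_hilbert \<Rightarrow> 'h" where
  "rank_one_sum I a b x = (\<Sum>\<^sub>\<infinity>i\<in>I. cinner (b i) x *\<^sub>C a i)"

lemma rank_one_abs_summable:
  fixes a b :: "'i \<Rightarrow> 'h::complex_hilbert"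
  assumes s: "(\<lambda>i. norm (a i) * norm (b i)) summable_on I"
  shows "(\<lambda>i. norm (cinner (b i) x *\<^sub>C a i)) summable_on I"
proof (rule Infinite_Sum.abs_summable_on_comparison_test')
  show "(\<lambda>i. norm x * (norm (a i) * norm (b i))) summable_on I"
    by (rule summable_on_cmult_right[OF s])
  show "norm (cinner (b i) x *\<^sub>C a i) \<le> norm x * (norm (a i) * norm (b i))" for i
    using mult_right_mono[OF cinner_Cauchy_Schwarz[of "b i" x], of "norm (a i)"]
    by (simp add: norm_scaleC mult_ac)
qed

lemma rank_one_has_sum:
  fixes a b :: "'i \<Rightarrow> 'h::complex_hilbert"
  assumes s: "(\<lambda>i. norm (a i) * norm (b i)) summable_on I"
  shows "((\<lambda>i. cinner (b i) x *\<^sub>C a i) has_sum rank_one_sum I a b x) I"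
  unfolding rank_one_sum_def
  by (rule has_sum_infsum[OF abs_summable_summable[OF rank_one_abs_summable[OF s]]])

lemma rank_one_bounded_clinear:
  fixes a b :: "'i \<Rightarrow> 'h::complex_hilbert"
  assumes s: "(\<lambda>i. norm (a i) * norm (b i)) summable_on I"
  shows "bounded_clinear (rank_one_sum I a b)"
  unfolding bounded_clinear_def
proof (intro conjI allI)
  let ?R = "rank_one_sum I a b"
  note hs = rank_one_has_sum[OF s]
  have add: "?R (x + y) = ?R x + ?R y" for x y
    by (rule has_sum_unique[OF hs])
       (use has_sum_add[OF hs hs, of x y] in \<open>simp add: cinner_add_right scaleC_add_left\<close>)
  have sc: "?R (c *\<^sub>C x) = c *\<^sub>C ?R x" for c x
    by (rule has_sum_unique[OF hs])
       (use has_sum_bounded_linear[OF bounded_linear_scaleC_right hs, of c x]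
         in \<open>simp add: cinner_scaleC_right scaleC_scaleC\<close>)
  then show "\<And>c x. ?R (c *\<^sub>C x) = c *\<^sub>C ?R x" .
  show "bounded_linear ?R"
  proof (rule bounded_linear_intro[where K = "\<Sum>\<^sub>\<infinity>i\<in>I. norm (a i) * norm (b i)"])
    show "?R (r *\<^sub>R x) = r *\<^sub>R ?R x" for r x using sc[of "of_real r" x] by (simp add: scaleC_of_real)
    fix x
    have "norm (?R x) \<le> (\<Sum>\<^sub>\<infinity>i\<in>I. norm (cinner (b i) x *\<^sub>C a i))"
      unfolding rank_one_sum_def by (rule norm_infsum_bound[OF rank_one_abs_summable[OF s]])
    also have "\<dots> \<le> (\<Sum>\<^sub>\<infinity>i\<in>I. norm x * (norm (a i) * norm (b i)))"
    proof (rule infsum_mono[OF rank_one_abs_summable[OF s] summable_on_cmult_right[OF s]])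
      show "norm (cinner (b i) x *\<^sub>C a i) \<le> norm x * (norm (a i) * norm (b i))" for i
        using mult_right_mono[OF cinner_Cauchy_Schwarz[of "b i" x], of "norm (a i)"]
        by (simp add: norm_scaleC mult_ac)
    qed
    finally show "norm (?R x) \<le> norm x * (\<Sum>\<^sub>\<infinity>i\<in>I. norm (a i) * norm (b i))"
      by (simp add: infsum_cmult_right'[symmetric])
  qed (rule add)
qed

lemma rank_one_adjoint:
  fixes a b :: "'i \<Rightarrow> 'h::complex_hilbert"
  assumes s: "(\<lambda>i. norm (a i) * norm (b i)) summable_on I"
  shows "cinner x (rank_one_sum I a b y) = cinner (rank_one_sum I b a x) y"
proof -
  have s': "(\<lambda>i. norm (b i) * norm (a i)) summable_on I" using s by (simp add: mult.commute)
  have "((\<lambda>i. cinner (b i) y * cinner x (a i)) has_sum cinner x (rank_one_sum I a b y)) I"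
    using has_sum_bounded_linear[OF bounded_linear_cinner_right rank_one_has_sum[OF s], of x y]
    by (simp add: cinner_scaleC_right)
  moreover have "((\<lambda>i. cinner (b i) y * cinner x (a i)) has_sum cinner (rank_one_sum I b a x) y) I"
    using has_sum_bounded_linear[OF bounded_linear_cinner_left rank_one_has_sum[OF s'], of x y]
    by (simp add: cinner_scaleC_left cinner_commute[of x] mult.commute)
  ultimately show ?thesis by (rule has_sum_unique)
qed

text \<open>Fubini for the double family <b_i, e><e, a_i>, absolutely summable by the Bessel product
  bound. Summing over the basis first gives <b_i, a_i> by Parseval; summing over i first gives the
  diagonal element at e. The value is therefore the same in every basis.\<close>

lemma rank_one_has_trace:
  fixes a b :: "'i \<Rightarrow> 'h::complex_hilbert"
  assumes s: "(\<lambda>i. norm (a i) * norm (b i)) summable_on I"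
  shows "((\<lambda>i. cinner (b i) (a i)) has_sum (\<Sum>\<^sub>\<infinity>i\<in>I. cinner (b i) (a i))) I"
    and "has_trace (rank_one_sum I a b) (\<Sum>\<^sub>\<infinity>i\<in>I. cinner (b i) (a i))"
proof -
  let ?t = "\<Sum>\<^sub>\<infinity>i\<in>I. cinner (b i) (a i)"
  have "(\<lambda>i. norm (cinner (b i) (a i))) summable_on I"
    by (rule Infinite_Sum.abs_summable_on_comparison_test'[OF s]) (metis cinner_Cauchy_Schwarz mult.commute)
  then show t: "((\<lambda>i. cinner (b i) (a i)) has_sum ?t) I"
    by (rule has_sum_infsum[OF abs_summable_summable])
  show "has_trace (rank_one_sum I a b) ?t"
    unfolding has_trace_def
  proof (intro conjI allI impI rank_one_bounded_clinear[OF s])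
    fix B :: "'h set" assume B: "conb B"
    then have on: "corthonormal B" unfolding conb_def by blast
    let ?f = "\<lambda>(i, e). cinner (b i) e * cinner e (a i)"
    have "(\<lambda>x. norm (?f x)) summable_on I \<times> B"
      unfolding Infinite_Sum.abs_summable_on_Sigma_iff
    proof (intro conjI ballI)
      show "(\<lambda>y. norm (?f (i, y))) summable_on B" for i
        using Bessel_product_summable(1)[OF on] by simp
      show "(\<lambda>i. norm (\<Sum>\<^sub>\<infinity>y\<in>B. norm (?f (i, y)))) summable_on I"
      proof (rule Infinite_Sum.abs_summable_on_comparison_test'[OF s])
        show "norm (\<Sum>\<^sub>\<infinity>y\<in>B. norm (?f (i, y))) \<le> norm (a i) * norm (b i)" for i
          using Bessel_product_summable(2)[OF on, of "b i" "a i"] by (simp add: infsum_nonneg mult.commute)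
      qed
    qed
    then have "?f summable_on I \<times> B" by (rule abs_summable_summable)
    then have "(?f has_sum ?t) (I \<times> B)"
      by (intro has_sum_SigmaI[OF _ t]) (use Parseval[OF B] in auto)
    then have "((\<lambda>(e, i). cinner (b i) e * cinner e (a i)) has_sum ?t) (B \<times> I)"
      by (subst (asm) has_sum_swap) (simp add: case_prod_unfold)
    then show "((\<lambda>e. cinner e (rank_one_sum I a b e)) has_sum ?t) B"
    proof (rule has_sum_SigmaD)
      fix e
      show "((\<lambda>i. (\<lambda>(e, i). cinner (b i) e * cinner e (a i)) (e, i)) has_sum cinner e (rank_one_sum I a b e)) I"
        using has_sum_bounded_linear[OF bounded_linear_cinner_right rank_one_has_sum[OF s], of e e]
        by (simp add: cinner_scaleC_right)
    qed
  qed
qed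

section \<open>Positive operators and quantum probability measures\<close>

text \<open>Polarization: reality of the form at x + y fixes the imaginary parts of <x, T y> and <y,
  T x>, reality at x + i y fixes the real parts, and together they are complex conjugates.\<close>

lemma positive_op_adjoint:
  assumes T: "positive_op T"
  shows "cinner x (T y) = cinner (T x) y"
proof -
  have lin: "T (a + b) = T a + T b" "T (c *\<^sub>C a) = c *\<^sub>C T a" for a b c
    using T unfolding positive_op_def bounded_clinear_def
    by (auto simp: linear_add bounded_linear.linear)
  have im: "Im (cinner z (T z)) = 0" for z
    using T unfolding positive_op_def by (auto simp: complex_nonneg_Reals_iff)
  have "Im (cinner x (T y)) + Im (cinner y (T x)) = 0"
    using im[of "x + y"] im[of x] im[of y] by (simp add: lin cinner_add_left cinner_add_right)
  moreover have "Re (cinner x (T y)) - Re (cinner y (T x)) = 0"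
    using im[of "x + \<i> *\<^sub>C y"] im[of x] im[of y]
    by (simp add: lin cinner_add_left cinner_add_right cinner_scaleC_left cinner_scaleC_right)
  ultimately have "cinner x (T y) = cnj (cinner y (T x))" by (simp add: complex_eq_iff)
  then show ?thesis by (metis cinner_commute)
qed

lemma positive_op_symmetric: "positive_op T \<Longrightarrow> inner x (T y) = inner y (T x)"
  using positive_op_adjoint[of T x y] by (metis Re_cinner inner_commute)

lemma positive_op_nonneg: "positive_op T \<Longrightarrow> 0 \<le> inner x (T x)"
  unfolding positive_op_def by (metis Re_cinner complex_nonneg_Reals_iff)

lemma positive_op_bounded_linear: "positive_op T \<Longrightarrow> bounded_linear T"
  unfolding positive_op_def bounded_clinear_def by blast

text \<open>Serves both \<open>diag_measure\<close> and \<open>outcome_measure\<close>.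
  \<open>measure_of\<close> returns the prescribed values once the set function is known to be
  positive and countably additive, and both set functions are real-valued, so that additivity is a
  statement about \<open>sums\<close>.\<close>

lemma emeasure_measure_of_real:
  fixes f :: "'a::topological_space set \<Rightarrow> real"
  assumes nonneg: "\<And>A. A \<in> sets borel \<Longrightarrow> 0 \<le> f A" and "f {} = 0"
    and sums: "\<And>A. range A \<subseteq> sets borel \<Longrightarrow> disjoint_family A \<Longrightarrow> (\<lambda>j. f (A j)) sums f (\<Union>j. A j)"
    and B: "B \<in> sets borel"
  shows "emeasure (measure_of UNIV (sets borel) (\<lambda>A. ennreal (f A))) B = ennreal (f B)"
proof (rule emeasure_measure_of[OF refl])
  let ?M = "measure_of UNIV (sets borel) (\<lambda>A. ennreal (f A))"
  have sets: "sets ?M = sets borel" using sets.sets_measure_of_eq[of borel] by simp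
  show "B \<in> sets ?M" using B sets by simp
  show "positive (sets ?M) (\<lambda>A. ennreal (f A))" using assms(2) by (simp add: positive_def)
  show "countably_additive (sets ?M) (\<lambda>A. ennreal (f A))"
    unfolding countably_additive_def sets
  proof (intro allI impI)
    fix A :: "nat \<Rightarrow> 'a set" assume A: "range A \<subseteq> sets borel" "disjoint_family A"
    have "(\<lambda>j. ennreal (f (A j))) sums ennreal (f (\<Union>j. A j))"
      using sums[OF A] A(1) nonneg by (subst sums_ennreal) auto
    then show "(\<Sum>j. ennreal (f (A j))) = ennreal (f (\<Union>j. A j))" by (rule sums_unique[symmetric])
  qed
qed auto

lemma qpm_positive: "quantum_prob_measure M \<Longrightarrow> A \<in> sets borel \<Longrightarrow> positive_op (M A)"
  unfolding quantum_prob_measure_def by blast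

lemma qpm_sums:
  "quantum_prob_measure M \<Longrightarrow> range A \<subseteq> sets borel \<Longrightarrow> disjoint_family A \<Longrightarrow>
    (\<lambda>j. M (A j) x) sums M (\<Union>j. A j) x"
  unfolding quantum_prob_measure_def by blast

text \<open>Countable additivity on the constant sequence of empty sets makes a constant series
  converge, which forces its term to vanish.\<close>

lemma qpm_empty:
  assumes "quantum_prob_measure M"
  shows "M {} x = 0"
proof -
  have "(\<lambda>j. M {} x) sums M {} x"
    using qpm_sums[OF assms, of "\<lambda>_. {}" x] by (simp add: disjoint_family_on_def)
  then have "(\<lambda>j::nat. M {} x) \<longlonglongrightarrow> 0" using summable_LIMSEQ_zero sums_summable by blast
  then show ?thesis using LIMSEQ_unique tendsto_const by blast
qed

lemma qpm_inner_sums: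
  assumes "quantum_prob_measure M" "range A \<subseteq> sets borel" "disjoint_family A"
  shows "(\<lambda>j. inner y (M (A j) x)) sums inner y (M (\<Union>j. A j) x)"
  using bounded_linear.sums[OF bounded_linear_inner_right qpm_sums[OF assms]] .

lemma sets_diag_measure [measurable_cong, simp]: "sets (diag_measure M x) = sets borel"
  unfolding diag_measure_def using sets.sets_measure_of_eq[of borel] by simp

lemma space_diag_measure [simp]: "space (diag_measure M x) = UNIV"
  unfolding diag_measure_def by (simp add: space_measure_of_conv)

lemma emeasure_diag_measure:
  assumes M: "quantum_prob_measure M" and A: "A \<in> sets borel"
  shows "emeasure (diag_measure M x) A = ennreal (inner x (M A x))"
  unfolding diag_measure_def Re_cinner
proof (rule emeasure_measure_of_real[OF _ _ _ A])
  show "0 \<le> inner x (M B x)" if "B \<in> sets borel" for B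
    by (rule positive_op_nonneg[OF qpm_positive[OF M that]])
qed (simp_all add: qpm_empty[OF M] qpm_inner_sums[OF M])

lemma measure_diag_measure:
  "quantum_prob_measure M \<Longrightarrow> A \<in> sets borel \<Longrightarrow> measure (diag_measure M x) A = inner x (M A x)"
  unfolding measure_def by (simp add: emeasure_diag_measure positive_op_nonneg[OF qpm_positive])

lemma finite_diag_measure: "quantum_prob_measure M \<Longrightarrow> finite_measure (diag_measure M x)"
  by (rule finite_measureI) (simp add: emeasure_diag_measure)

lemma qpm_UNIV: "quantum_prob_measure M \<Longrightarrow> M UNIV x = x"
  unfolding quantum_prob_measure_def by simp

section \<open>Approximation by step functions\<close>

text \<open>The function \<phi> acts on the values of g, so that one partition, the level sets of g,
  serves all the integrands built from g.\<close>

lemma integral_simple_compose: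
  fixes \<phi> :: "'b \<Rightarrow> real"
  assumes N: "finite_measure N" "sets N = sets borel" and g: "simple_function borel g"
  shows "integrable N (\<lambda>l. \<phi> (g l))"
    and "(\<integral>l. \<phi> (g l) \<partial>N) = (\<Sum>v\<in>range g. \<phi> v * measure N (g -` {v}))"
proof -
  interpret finite_measure N by (rule N)
  have fin: "finite (range g)" and ms: "\<And>v. v \<in> range g \<Longrightarrow> g -` {v} \<in> sets N"
    using g N(2) unfolding simple_function_def by auto
  have eq: "\<phi> (g l) = (\<Sum>v\<in>range g. \<phi> v * indicator (g -` {v}) l)" for l
  proof -
    have "(\<Sum>v\<in>range g. \<phi> v * indicator (g -` {v}) l) = (\<Sum>v\<in>range g. if v = g l then \<phi> v else 0)"
      by (intro sum.cong refl) (auto simp: indicator_def)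
    then show ?thesis using fin by simp
  qed
  have int: "integrable N (\<lambda>l. \<phi> v * indicator (g -` {v}) l)" if "v \<in> range g" for v
    using ms[OF that] by (intro integrable_mult_right) (simp add: emeasure_eq_measure)
  show "integrable N (\<lambda>l. \<phi> (g l))" unfolding eq by (intro Bochner_Integration.integrable_sum int)
  have sp: "space N = UNIV" using N(2) sets_eq_imp_space_eq by fastforce
  show "(\<integral>l. \<phi> (g l) \<partial>N) = (\<Sum>v\<in>range g. \<phi> v * measure N (g -` {v}))"
    unfolding eq using int ms by (subst Bochner_Integration.integral_sum) (auto simp: sp)
qed

text \<open>The operator integral of the step function \<phi> o g. Keeping g and \<phi> apart lets
  all coordinates of a vector-valued g, and their linear combinations, share the same cells.\<close>

definition qpm_step ::
    "((real^'n) set \<Rightarrow> 'h::complex_hilbert \<Rightarrow> 'h) \<Rightarrow> (real^'n \<Rightarrow> 'b) \<Rightarrow> ('b \<Rightarrow> real) \<Rightarrow> 'h \<Rightarrow> 'h" where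
  "qpm_step M g \<phi> x = (\<Sum>v\<in>range g. \<phi> v *\<^sub>R M (g -` {v}) x)"

section \<open>Quadratic form and norm bound of a step integral\<close>

context
  fixes M :: "(real^'n) set \<Rightarrow> 'h::complex_hilbert \<Rightarrow> 'h" and g :: "real^'n \<Rightarrow> 'b"
  assumes M: "quantum_prob_measure M" and g: "simple_function borel g"
begin

lemma positive_op_step_cell: "v \<in> range g \<Longrightarrow> positive_op (M (g -` {v}))"
  using g unfolding simple_function_def by (auto intro!: qpm_positive[OF M])

lemma measure_step_cell: "v \<in> range g \<Longrightarrow> measure (diag_measure M x) (g -` {v}) = inner x (M (g -` {v}) x)"
  using g unfolding simple_function_def by (auto intro!: measure_diag_measure[OF M])

lemma step_cell_sum: "(\<Sum>v\<in>range g. inner x (M (g -` {v}) x)) = (norm x)\<^sup>2"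
proof -
  have "(\<Sum>v\<in>range g. inner x (M (g -` {v}) x)) = (\<integral>l. 1 \<partial>diag_measure M x)"
    using integral_simple_compose(2)[OF finite_diag_measure[OF M] sets_diag_measure g, where \<phi> = "\<lambda>_. 1"]
    by (simp add: measure_step_cell)
  also have "\<dots> = measure (diag_measure M x) UNIV" by simp
  also have "\<dots> = (norm x)\<^sup>2"
    by (subst measure_diag_measure[OF M]) (simp_all add: qpm_UNIV[OF M] power2_norm_eq_inner)
  finally show ?thesis .
qed

lemma qpm_step_add: "qpm_step M g \<phi> (x + y) = qpm_step M g \<phi> x + qpm_step M g \<phi> y"
  unfolding qpm_step_def sum.distrib[symmetric]
  by (intro sum.cong refl)
     (simp add: linear_add[OF bounded_linear.linear[OF positive_op_bounded_linear[OF positive_op_step_cell]]]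
       scaleR_add_right)

lemma qpm_step_diff: "qpm_step M g \<phi> (x - y) = qpm_step M g \<phi> x - qpm_step M g \<phi> y"
  using qpm_step_add[of \<phi> "x - y" y] by simp

lemma qpm_step_symmetric: "inner x (qpm_step M g \<phi> y) = inner y (qpm_step M g \<phi> x)"
  unfolding qpm_step_def inner_sum_right inner_scaleR_right
  by (intro sum.cong refl arg_cong2[where f = "(*)"] positive_op_symmetric positive_op_step_cell)

lemma qpm_step_form: "inner x (qpm_step M g \<phi> x) = (\<integral>l. \<phi> (g l) \<partial>diag_measure M x)"
  by (simp add: qpm_step_def inner_sum_right measure_step_cell
      integral_simple_compose(2)[OF finite_diag_measure[OF M] sets_diag_measure g])

text \<open>The operator inequality (\<integral> \<phi> dM)^2 \<le> \<integral> \<phi>^2 dM on a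
  finite partition. It is stated as a sum over cells so that it can be added over eigenvectors
  before being read as an integral against the outcome distribution.\<close>

lemma qpm_step_norm:
  "(norm (qpm_step M g \<phi> x))\<^sup>2 \<le> (\<Sum>v\<in>range g. (\<phi> v)\<^sup>2 * inner x (M (g -` {v}) x))"
proof -
  let ?u = "qpm_step M g \<phi> x" and ?T = "\<lambda>v. M (g -` {v})"
  have "0 \<le> (\<Sum>v\<in>range g. inner (\<phi> v *\<^sub>R x - ?u) (?T v (\<phi> v *\<^sub>R x - ?u)))"
    by (intro sum_nonneg positive_op_nonneg positive_op_step_cell)
  also have "\<dots> = (\<Sum>v\<in>range g. (\<phi> v)\<^sup>2 * inner x (?T v x) - 2 * (\<phi> v * inner ?u (?T v x)) + inner ?u (?T v ?u))"
  proof (intro sum.cong refl)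
    fix v assume v: "v \<in> range g"
    have lin: "linear (?T v)"
      by (rule bounded_linear.linear[OF positive_op_bounded_linear[OF positive_op_step_cell[OF v]]])
    show "inner (\<phi> v *\<^sub>R x - ?u) (?T v (\<phi> v *\<^sub>R x - ?u))
        = (\<phi> v)\<^sup>2 * inner x (?T v x) - 2 * (\<phi> v * inner ?u (?T v x)) + inner ?u (?T v ?u)"
      using positive_op_symmetric[OF positive_op_step_cell[OF v], of x ?u]
      by (simp add: linear_diff[OF lin] linear_scale[OF lin] inner_diff_left inner_diff_right
          power2_eq_square algebra_simps)
  qed
  also have "\<dots> = (\<Sum>v\<in>range g. (\<phi> v)\<^sup>2 * inner x (?T v x)) - 2 * (\<Sum>v\<in>range g. \<phi> v * inner ?u (?T v x))
      + (\<Sum>v\<in>range g. inner ?u (?T v ?u))"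
    by (simp add: sum.distrib sum_subtractf sum_distrib_left)
  \<comment> \<open>The weighted cells add up to \<open>?u\<close> again, so the cross term
    contributes -2 |u|^2; the last sum gives + |u|^2 because the cells add up to the
    identity.\<close>
  also have "(\<Sum>v\<in>range g. \<phi> v * inner ?u (?T v x)) = inner ?u ?u"
    by (subst (2) qpm_step_def) (simp add: inner_sum_right)
  also have "(\<Sum>v\<in>range g. inner ?u (?T v ?u)) = (norm ?u)\<^sup>2" by (rule step_cell_sum)
  finally show ?thesis by (simp add: power2_norm_eq_inner)
qed

lemma qpm_step_norm_integral: "(norm (qpm_step M g \<phi> x))\<^sup>2 \<le> (\<integral>l. (\<phi> (g l))\<^sup>2 \<partial>diag_measure M x)"
  using qpm_step_norm[of \<phi> x]
  by (simp add: measure_step_cell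
      integral_simple_compose(2)[OF finite_diag_measure[OF M] sets_diag_measure g, where \<phi> = "\<lambda>v. (\<phi> v)\<^sup>2"])

end

text \<open>Each coordinate is approximated by real simple functions, and the coordinates are
  assembled into one vector-valued function to obtain a common partition: its range lies in a finite
  product and its level sets are finite intersections. The factor 2 comes from the metric
  approximation result and makes dominated convergence applicable.\<close>

lemma simple_approximation:
  fixes \<theta> :: "real^'n"
  obtains h :: "nat \<Rightarrow> real^'n \<Rightarrow> real^'n"
  where "\<And>n. simple_function borel (h n)"
    and "\<And>l i. (\<lambda>n. h n l $ i) \<longlonglongrightarrow> l $ i - \<theta> $ i"
    and "\<And>n l i. \<bar>h n l $ i\<bar> \<le> 2 * \<bar>l $ i - \<theta> $ i\<bar>"
proof -
  have "\<exists>F. (\<forall>n. simple_function borel (F n)) \<and>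
      (\<forall>l\<in>space borel. (\<lambda>n. F n l) \<longlonglongrightarrow> l $ i - \<theta> $ i) \<and>
      (\<forall>n. \<forall>l\<in>space borel. dist (F n l) 0 \<le> 2 * dist (l $ i - \<theta> $ i) 0)" for i
    by (rule borel_measurable_implies_sequence_metric) measurable
  then obtain F where F: "\<And>i n. simple_function borel (F i n)"
      "\<And>i l. (\<lambda>n. F i n l) \<longlonglongrightarrow> l $ i - \<theta> $ i"
      "\<And>i n l. \<bar>F i n l\<bar> \<le> 2 * \<bar>l $ i - \<theta> $ i\<bar>"
    unfolding space_borel dist_real_def by (simp add: choice_iff) metis
  let ?h = "\<lambda>n l. \<chi> i. F i n l"
  have "simple_function borel (?h n)" for n
    unfolding simple_function_def
  proof (intro conjI ballI)
    have "range (?h n) \<subseteq> (\<lambda>f. \<chi> i. f i) ` (PiE UNIV (\<lambda>i. range (F i n)))" by auto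
    moreover have "finite (PiE UNIV (\<lambda>i. range (F i n)))"
      using F(1) by (intro finite_PiE) (auto simp: simple_function_def)
    ultimately show "finite (?h n ` space borel)" unfolding space_borel by (rule finite_surj[rotated])
    fix v
    have "?h n -` {v} \<inter> space borel = (\<Inter>i. F i n -` {v $ i})" by (auto simp: vec_eq_iff)
    moreover have "F i n -` {v $ i} \<in> sets borel" for i
      by (rule measurable_sets_borel[OF borel_measurable_simple_function[OF F(1)]]) simp
    ultimately show "?h n -` {v} \<inter> space borel \<in> sets borel" by auto
  qed
  then show ?thesis using F(2,3) by (intro that[of ?h]) auto
qed

section \<open>The outcome distribution\<close>

text \<open>The weights are the diagonal elements of \<rho> at E. Extending E to an orthonormal
  basis places them inside the convergent trace series.\<close>

lemma spectral_weights_summable: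
  assumes \<rho>: "density_operator \<rho>" and sd: "spectral_decomp \<rho> E w"
  shows "w summable_on E"
proof -
  have on: "corthonormal E" using sd unfolding spectral_decomp_def by simp
  obtain B where B: "E \<subseteq> B" "conb B" using corthonormal_extends_conb[OF on] .
  have "((\<lambda>e. cinner e (\<rho> e)) has_sum 1) B"
    using \<rho> B(2) unfolding density_operator_def has_trace_def by simp
  then have "(\<lambda>e. cinner e (\<rho> e)) summable_on E"
    using B(1) has_sum_imp_summable summable_on_subset_banach by metis
  then have "(\<lambda>e. Re (cinner e (\<rho> e))) summable_on E"
    by (rule summable_on_bounded_linear[OF bounded_linear_Re])
  moreover have "Re (cinner e (\<rho> e)) = w e" if "e \<in> E" for e
    using on that by (simp add: spectral_decomp_eigen[OF sd that] cinner_scaleC_right corthonormal_def)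
  ultimately show ?thesis by (simp cong: summable_on_cong)
qed

lemma corthonormal_norm: "corthonormal E \<Longrightarrow> e \<in> E \<Longrightarrow> norm e = 1"
  using cinner_self[of e] unfolding corthonormal_def
  by (metis norm_ge_zero of_real_1 of_real_eq_iff power2_eq_1_iff le_minus_one_simps(3))

text \<open>Moving the self-adjoint T onto the eigenvectors writes \<rho> T as the sum of |w_e e><T
  e|, which is trace class because the weights are summable and T is bounded.\<close>

lemma Tr_state_mult:
  assumes \<rho>: "density_operator \<rho>" and sd: "spectral_decomp \<rho> E w" and T: "positive_op T"
  shows "((\<lambda>e. w e * inner e (T e)) has_sum Re (Tr (\<rho> \<circ> T))) E"
proof -
  have on: "corthonormal E" and pos: "\<And>e. e \<in> E \<Longrightarrow> 0 < w e"
    and hs: "\<And>x. ((\<lambda>e. (of_real (w e) * cinner e x) *\<^sub>C e) has_sum \<rho> x) E"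
    using sd unfolding spectral_decomp_def by simp_all
  obtain K where K: "\<And>x. norm (T x) \<le> norm x * K"
    using bounded_linear.bounded[OF positive_op_bounded_linear[OF T]] by blast
  let ?a = "\<lambda>e. w e *\<^sub>R e"
  have s: "(\<lambda>e. norm (?a e) * norm (T e)) summable_on E"
  proof (rule summable_on_comparison_test)
    show "(\<lambda>e. w e * K) summable_on E"
      by (rule summable_on_cmult_left[OF spectral_weights_summable[OF \<rho> sd]])
    show "norm (?a e) * norm (T e) \<le> w e * K" if "e \<in> E" for e
      using K[of e] pos[OF that] corthonormal_norm[OF on that] by simp
  qed simp
  have "\<rho> \<circ> T = rank_one_sum E ?a T"
  proof
    fix x
    have "((\<lambda>e. cinner (T e) x *\<^sub>C ?a e) has_sum \<rho> (T x)) E"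
      using hs[of "T x"] unfolding positive_op_adjoint[OF T]
      by (simp add: scaleC_of_real[symmetric] scaleC_scaleC mult.commute)
    then show "(\<rho> \<circ> T) x = rank_one_sum E ?a T x"
      using has_sum_unique[OF rank_one_has_sum[OF s]] by simp
  qed
  then have "has_trace (\<rho> \<circ> T) (\<Sum>\<^sub>\<infinity>e\<in>E. cinner (T e) (?a e))"
    using rank_one_has_trace(2)[OF s] by simp
  then have "((\<lambda>e. cinner (T e) (?a e)) has_sum Tr (\<rho> \<circ> T)) E"
    using rank_one_has_trace(1)[OF s] by (simp add: Tr_eq)
  from has_sum_Re[OF this] show ?thesis
    by (simp add: cinner_scaleR_right Re_cinner inner_commute)
qed

section \<open>Countable additivity of the outcome distribution and its domination of finite
  eigenvector sums\<close>

context
  fixes M :: "(real^'n) set \<Rightarrow> 'h::complex_hilbert \<Rightarrow> 'h" and \<rho> :: "'h \<Rightarrow> 'h" and E w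
  assumes M: "quantum_prob_measure M" and \<rho>: "density_operator \<rho>" and sd: "spectral_decomp \<rho> E w"
begin

lemma outcome_weight_nonneg: "e \<in> E \<Longrightarrow> A \<in> sets borel \<Longrightarrow> 0 \<le> w e * inner e (M A e)"
  using sd positive_op_nonneg[OF qpm_positive[OF M]]
  by (simp add: spectral_decomp_def order_less_imp_le)

text \<open>Tonelli for the nonnegative family w_e <e, M(A_j) e>: summing over j uses additivity of
  M at each eigenvector, summing over e uses the trace formula.\<close>

lemma outcome_Tr_sums:
  assumes A: "range A \<subseteq> sets borel" "disjoint_family A"
  shows "(\<lambda>j. Re (Tr (\<rho> \<circ> M (A j)))) sums Re (Tr (\<rho> \<circ> M (\<Union>j. A j)))"
proof -
  have mA: "A j \<in> sets borel" for j using A(1) by auto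
  then have mU: "(\<Union>j. A j) \<in> sets borel" by auto
  let ?f = "\<lambda>(e, j). w e * inner e (M (A j) e)" and ?g = "\<lambda>e. w e * inner e (M (\<Union>j. A j) e)"
  have g: "(?g has_sum Re (Tr (\<rho> \<circ> M (\<Union>j. A j)))) E"
    by (rule Tr_state_mult[OF \<rho> sd qpm_positive[OF M mU]])
  have f: "((\<lambda>j. ?f (e, j)) has_sum ?g e) UNIV" if "e \<in> E" for e
    using outcome_weight_nonneg[OF that mA] sums_mult[OF qpm_inner_sums[OF M A, of e e], of "w e"]
    by (intro sums_nonneg_imp_has_sum) auto
  have "?f summable_on E \<times> UNIV"
    by (rule summable_on_SigmaI[OF f has_sum_imp_summable[OF g]]) (auto intro: outcome_weight_nonneg mA)
  with f g have "(?f has_sum Re (Tr (\<rho> \<circ> M (\<Union>j. A j)))) (E \<times> UNIV)"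
    by (rule has_sum_SigmaI)
  then have "((\<lambda>(j, e). w e * inner e (M (A j) e)) has_sum Re (Tr (\<rho> \<circ> M (\<Union>j. A j)))) (UNIV \<times> E)"
    by (subst (asm) has_sum_swap) (simp add: case_prod_unfold)
  then have "((\<lambda>j. Re (Tr (\<rho> \<circ> M (A j)))) has_sum Re (Tr (\<rho> \<circ> M (\<Union>j. A j)))) UNIV"
    by (rule has_sum_SigmaD) (use Tr_state_mult[OF \<rho> sd qpm_positive[OF M mA]] in simp)
  then show ?thesis by (rule has_sum_imp_sums)
qed

lemma outcome_Tr_nonneg: "A \<in> sets borel \<Longrightarrow> 0 \<le> Re (Tr (\<rho> \<circ> M A))"
  by (rule has_sum_nonneg[OF Tr_state_mult[OF \<rho> sd qpm_positive[OF M]]])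
     (auto intro: outcome_weight_nonneg)

lemma emeasure_outcome_measure:
  assumes A: "A \<in> sets borel"
  shows "emeasure (outcome_measure M \<rho>) A = ennreal (Re (Tr (\<rho> \<circ> M A)))"
  unfolding outcome_measure_def
proof (rule emeasure_measure_of_real[OF outcome_Tr_nonneg _ outcome_Tr_sums A])
  have "((\<lambda>e. w e * inner e (M {} e)) has_sum Re (Tr (\<rho> \<circ> M {}))) E"
    by (rule Tr_state_mult[OF \<rho> sd qpm_positive[OF M]]) simp
  then have "((\<lambda>e. 0) has_sum Re (Tr (\<rho> \<circ> M {}))) E" by (simp add: qpm_empty[OF M])
  then show "Re (Tr (\<rho> \<circ> M {})) = 0" using has_sum_unique[OF _ has_sum_0] by blast
qed

lemma sets_outcome_measure: "sets (outcome_measure M \<rho>) = sets borel"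
  unfolding outcome_measure_def using sets.sets_measure_of_eq[of borel] by simp

lemma finite_outcome_measure: "finite_measure (outcome_measure M \<rho>)"
proof (rule finite_measureI)
  have "space (outcome_measure M \<rho>) = UNIV"
    unfolding outcome_measure_def by (simp add: space_measure_of_conv)
  then show "emeasure (outcome_measure M \<rho>) (space (outcome_measure M \<rho>)) \<noteq> \<infinity>"
    by (simp add: emeasure_outcome_measure)
qed

lemma outcome_measure_ge_partial_sum:
  assumes A: "A \<in> sets borel" and F: "finite F" "F \<subseteq> E"
  shows "(\<Sum>e\<in>F. w e * inner e (M A e)) \<le> measure (outcome_measure M \<rho>) A"
  using finite_sum_le_has_sum[OF Tr_state_mult[OF \<rho> sd qpm_positive[OF M A]] F]
    outcome_weight_nonneg[OF _ A] outcome_Tr_nonneg[OF A]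
  by (simp add: measure_def emeasure_outcome_measure[OF A])

text \<open>The cellwise bound is added over eigenvectors and the two finite sums are exchanged;
  each cell then carries at most its outcome probability.\<close>

lemma qpm_step_outcome_bound:
  assumes g: "simple_function borel g" and F: "finite F" "F \<subseteq> E"
  shows "(\<Sum>e\<in>F. w e * (norm (qpm_step M g \<phi> e))\<^sup>2) \<le> (\<integral>l. (\<phi> (g l))\<^sup>2 \<partial>outcome_measure M \<rho>)"
proof -
  have pos: "0 < w e" if "e \<in> F" for e using sd F that by (auto simp: spectral_decomp_def)
  have ms: "g -` {v} \<in> sets borel" if "v \<in> range g" for v
    using g that by (auto simp: simple_function_def)
  have "(\<Sum>e\<in>F. w e * (norm (qpm_step M g \<phi> e))\<^sup>2)
      \<le> (\<Sum>e\<in>F. w e * (\<Sum>v\<in>range g. (\<phi> v)\<^sup>2 * inner e (M (g -` {v}) e)))"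
    by (intro sum_mono mult_left_mono qpm_step_norm M g less_imp_le pos)
  also have "\<dots> = (\<Sum>v\<in>range g. (\<phi> v)\<^sup>2 * (\<Sum>e\<in>F. w e * inner e (M (g -` {v}) e)))"
    unfolding sum_distrib_left by (subst sum.swap) (simp add: mult_ac)
  also have "\<dots> \<le> (\<Sum>v\<in>range g. (\<phi> v)\<^sup>2 * measure (outcome_measure M \<rho>) (g -` {v}))"
    by (intro sum_mono mult_left_mono outcome_measure_ge_partial_sum ms F) auto
  also have "\<dots> = (\<integral>l. (\<phi> (g l))\<^sup>2 \<partial>outcome_measure M \<rho>)"
    using integral_simple_compose(2)[OF finite_outcome_measure sets_outcome_measure g,
        where \<phi> = "\<lambda>v. (\<phi> v)\<^sup>2"] by simp
  finally show ?thesis .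
qed

end

section \<open>Weak convergence of step integrals\<close>

lemma csubspace_diff:
  assumes "csubspace D" "x \<in> D" "y \<in> D"
  shows "x - y \<in> D"
proof -
  have "(-1) *\<^sub>C y = - y" using scaleC_of_real[of "-1" y] by simp
  then show ?thesis using assms unfolding csubspace_def by (metis diff_conv_add_uminus)
qed

lemma hermitian_op_diff:
  assumes X: "hermitian_op X" and "x \<in> udom X" "y \<in> udom X"
  shows "uapp X (x - y) = uapp X x - uapp X y"
proof -
  have "x - y \<in> udom X" using X assms csubspace_diff unfolding hermitian_op_def by blast
  then have "uapp X ((x - y) + y) = uapp X (x - y) + uapp X y"
    using X assms(3) unfolding hermitian_op_def by blast
  then show ?thesis by simp
qed

text \<open>The diagonal measure is finite, so the square-integrability that defines the domain also
  yields integrability, by |a| \<le> 1 + a^2. Centring at a constant preserves both.\<close>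

lemma qpm_integral_integrable:
  assumes M: "quantum_prob_measure M" and X: "is_qpm_integral M (\<lambda>l. l $ i) X" and x: "x \<in> udom X"
  shows "integrable (diag_measure M x) (\<lambda>l. l $ i - c)"
    and "integrable (diag_measure M x) (\<lambda>l. (l $ i - c)\<^sup>2)"
proof -
  interpret finite_measure "diag_measure M x" by (rule finite_diag_measure[OF M])
  have sq: "integrable (diag_measure M x) (\<lambda>l. (l $ i)\<^sup>2)"
    using X x unfolding is_qpm_integral_def by simp
  have m: "(\<lambda>l. l $ i) \<in> borel_measurable (diag_measure M x)"
    unfolding measurable_cong_sets[OF sets_diag_measure refl] by measurable
  have 1: "integrable (diag_measure M x) (\<lambda>l. l $ i)"
  proof (rule Bochner_Integration.integrable_bound)
    show "integrable (diag_measure M x) (\<lambda>l. 1 + (l $ i)\<^sup>2)" using sq by simp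
    have "\<bar>a\<bar> \<le> 1 + a\<^sup>2" for a :: real
      using zero_le_power2[of "\<bar>a\<bar> - 1"] by (simp add: power2_diff)
    then show "AE l in diag_measure M x. norm (l $ i) \<le> norm (1 + (l $ i)\<^sup>2)"
      by (simp add: abs_of_nonneg add_nonneg_nonneg)
  qed (rule m)
  then show "integrable (diag_measure M x) (\<lambda>l. l $ i - c)" by simp
  show "integrable (diag_measure M x) (\<lambda>l. (l $ i - c)\<^sup>2)"
    using 1 sq by (simp add: power2_diff)
qed

text \<open>Here y is arbitrary although the limit is first obtained on the domain only: the later
  choice of y is a combination of the vectors q_i e, which need not lie in the domain of any
  q_i.\<close>

lemma qpm_step_weak_limit:
  assumes M: "quantum_prob_measure M" and X: "is_qpm_integral M (\<lambda>l. l $ i) X" and x: "x \<in> udom X"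
    and h: "\<And>n. simple_function borel (h n)"
      "\<And>l. (\<lambda>n. h n l $ i) \<longlonglongrightarrow> l $ i - c"
      "\<And>n l. \<bar>h n l $ i\<bar> \<le> 2 * \<bar>l $ i - c\<bar>"
  shows "(\<lambda>n. inner y (qpm_step M (h n) (\<lambda>v. v $ i) x)) \<longlonglongrightarrow> inner y (uapp X x - c *\<^sub>R x)"
proof -
  have herm: "hermitian_op X" using X unfolding is_qpm_integral_def by blast
  have sub: "csubspace (udom X)" and dense: "closure (udom X) = UNIV"
    and Xadd: "\<And>x y. x \<in> udom X \<Longrightarrow> y \<in> udom X \<Longrightarrow> uapp X (x + y) = uapp X x + uapp X y"
    and Xsym: "\<And>x y. x \<in> udom X \<Longrightarrow> y \<in> udom X \<Longrightarrow> inner (uapp X x) y = inner x (uapp X y)"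
    using herm unfolding hermitian_op_def by (auto simp flip: Re_cinner)
  let ?A = "\<lambda>n. qpm_step M (h n) (\<lambda>v. v $ i)" and ?X = "\<lambda>x. uapp X x - c *\<^sub>R x"
  have form: "(\<lambda>n. inner z (?A n z)) \<longlonglongrightarrow> inner z (?X z)" if z: "z \<in> udom X" for z
  proof -
    have "(\<lambda>n. \<integral>l. h n l $ i \<partial>diag_measure M z) \<longlonglongrightarrow> (\<integral>l. l $ i - c \<partial>diag_measure M z)"
    proof (rule integral_dominated_convergence)
      show "integrable (diag_measure M z) (\<lambda>l. 2 * \<bar>l $ i - c\<bar>)"
        using qpm_integral_integrable(1)[OF M X z, of c] by simp
      show "(\<lambda>l. h n l $ i) \<in> borel_measurable (diag_measure M z)" for n
        by (rule borel_measurable_integrable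
            [OF integral_simple_compose(1)[OF finite_diag_measure[OF M] sets_diag_measure h(1)]])
    qed (use h qpm_integral_integrable(1)[OF M X z, of c] in auto)
    moreover have "(\<integral>l. l $ i - c \<partial>diag_measure M z) = inner z (?X z)"
    proof -
      interpret finite_measure "diag_measure M z" by (rule finite_diag_measure[OF M])
      have "of_real (\<integral>l. l $ i \<partial>diag_measure M z) = cinner z (uapp X z)"
        using X z unfolding is_qpm_integral_def by simp
      then have "(\<integral>l. l $ i \<partial>diag_measure M z) = inner z (uapp X z)" by (metis Re_cinner Re_complex_of_real)
      moreover have "measure (diag_measure M z) UNIV = inner z z"
        by (subst measure_diag_measure[OF M]) (simp_all add: qpm_UNIV[OF M])
      ultimately show ?thesis
        using qpm_integral_integrable(1)[OF M X z, of 0] by (simp add: inner_diff_right)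
    qed
    ultimately show ?thesis by (simp add: qpm_step_form[OF M h(1)])
  qed
  have weak: "(\<lambda>n. inner z (?A n x)) \<longlonglongrightarrow> inner z (?X x)" if z: "z \<in> udom X" for z
  proof -
    have d: "x + z \<in> udom X" "x - z \<in> udom X"
      using sub x z csubspace_diff unfolding csubspace_def by auto
    \<comment> \<open>Two polarization terms suffice, since the step integrals and the limit
      operator are symmetric for the real inner product.\<close>
    have "inner z (?A n x) = (inner (x + z) (?A n (x + z)) - inner (x - z) (?A n (x - z))) / 4" for n
      using qpm_step_symmetric[OF M h(1), of x n _ z]
      by (simp add: qpm_step_add[OF M h(1)] qpm_step_diff[OF M h(1)] inner_add_left inner_add_right
          inner_diff_left inner_diff_right)
    moreover have "inner z (?X x) = (inner (x + z) (?X (x + z)) - inner (x - z) (?X (x - z))) / 4"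
      using Xsym[OF x z]
      by (simp add: Xadd[OF x z] hermitian_op_diff[OF herm x z] inner_add_left inner_add_right
          inner_diff_left inner_diff_right inner_commute algebra_simps)
    ultimately show ?thesis
      by (simp only:) (intro tendsto_divide tendsto_diff form d tendsto_const, simp)
  qed
  \<comment> \<open>The 4 is the square of the factor 2 in the domination of h.\<close>
  define K where "K = sqrt (\<integral>l. 4 * (l $ i - c)\<^sup>2 \<partial>diag_measure M x)"
  have bound: "norm (?A n x) \<le> K" for n
  proof -
    have "(norm (?A n x))\<^sup>2 \<le> (\<integral>l. (h n l $ i)\<^sup>2 \<partial>diag_measure M x)"
      by (rule qpm_step_norm_integral[OF M h(1)])
    also have "\<dots> \<le> (\<integral>l. 4 * (l $ i - c)\<^sup>2 \<partial>diag_measure M x)"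
    proof (rule integral_mono)
      show "integrable (diag_measure M x) (\<lambda>l. (h n l $ i)\<^sup>2)"
        by (rule integral_simple_compose(1)[OF finite_diag_measure[OF M] sets_diag_measure h(1)])
      show "(h n l $ i)\<^sup>2 \<le> 4 * (l $ i - c)\<^sup>2" for l
        using power_mono[OF h(3)[of n l], of 2] by (simp add: power_mult_distrib)
    qed (use qpm_integral_integrable(2)[OF M X x, of c] in simp)
    finally show ?thesis unfolding K_def by (rule real_le_rsqrt)
  qed
  show ?thesis
  proof (rule LIMSEQ_I)
    fix r :: real assume r: "r > 0"
    \<comment> \<open>A bound on the distance of \<open>?A n x\<close> from its limit, uniform in n;
      the summand 1 makes it positive and hence a legitimate divisor.\<close>
    define C where "C = K + norm (?X x) + 1"
    have "K \<ge> 0" using bound[of 0] norm_ge_zero order_trans by blast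
    then have C: "C > 0" unfolding C_def by (simp add: add_nonneg_pos)
    obtain z where z: "z \<in> udom X" "dist z y < r / (2 * C)"
      using dense r C closure_approachable[of y "udom X"] by (metis UNIV_I divide_pos_pos mult_pos_pos zero_less_numeral)
    obtain N where N: "\<And>n. n \<ge> N \<Longrightarrow> norm (inner z (?A n x) - inner z (?X x)) < r / 2"
      using LIMSEQ_D[OF weak[OF z(1)], of "r / 2"] r by auto
    have "norm (inner y (?A n x) - inner y (?X x)) < r" if "n \<ge> N" for n
    proof -
      have "\<bar>inner (y - z) (?A n x - ?X x)\<bar> \<le> norm (y - z) * norm (?A n x - ?X x)"
        by (rule Cauchy_Schwarz_ineq2)
      also have "\<dots> \<le> r / (2 * C) * C"
      proof (rule mult_mono)
        show "norm (y - z) \<le> r / (2 * C)" using z(2) by (simp add: dist_norm norm_minus_commute)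
        show "norm (?A n x - ?X x) \<le> C"
          using bound[of n] norm_triangle_ineq4[of "?A n x" "?X x"] by (simp add: C_def)
      qed (use r C in simp_all)
      also have "\<dots> = r / 2" using C by simp
      finally have "\<bar>inner (y - z) (?A n x - ?X x)\<bar> \<le> r / 2" .
      moreover have "inner y (?A n x) - inner y (?X x)
          = inner (y - z) (?A n x - ?X x) + (inner z (?A n x) - inner z (?X x))"
        by (simp add: inner_diff_left inner_diff_right algebra_simps)
      ultimately show ?thesis using N[OF that] unfolding real_norm_def by linarith
    qed
    then show "\<exists>N. \<forall>n\<ge>N. norm (inner y (?A n x) - inner y (?X x)) < r" by blast
  qed
qed

section \<open>The variance bound over finitely many eigenvectors\<close>

lemma qpm_step_linear:
  fixes c :: "'n::finite \<Rightarrow> real"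
  shows "qpm_step M g (\<lambda>v. \<Sum>i\<in>UNIV. c i * v $ i) x = (\<Sum>i\<in>UNIV. c i *\<^sub>R qpm_step M g (\<lambda>v::real^'n. v $ i) x)"
  unfolding qpm_step_def scaleR_sum_right scaleR_sum_left by (subst sum.swap) simp

text \<open>Norms are not continuous under weak limits. The bound 2 <Z, u> - |Z|^2 \<le> |u|^2 is
  affine in the step integral u, so it passes to the limit and becomes |Z|^2 there. Finiteness of F
  allows the limit to be taken termwise.\<close>

lemma qpm_variance_bound:
  fixes M :: "(real^'n) set \<Rightarrow> 'h::complex_hilbert \<Rightarrow> 'h" and \<theta> c :: "real^'n"
  assumes M: "quantum_prob_measure M" and q: "\<And>i. is_qpm_integral M (\<lambda>l. l $ i) (q i)"
    and \<rho>: "density_operator \<rho>" and sd: "spectral_decomp \<rho> E w" and dom: "\<And>i. E \<subseteq> udom (q i)"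
    and int: "\<And>i k. integrable (outcome_measure M \<rho>) (\<lambda>l. (l $ i - \<theta> $ i) * (l $ k - \<theta> $ k))"
    and F: "finite F" "F \<subseteq> E"
  shows "(\<Sum>e\<in>F. w e * (norm (\<Sum>i\<in>UNIV. c $ i *\<^sub>R (uapp (q i) e - \<theta> $ i *\<^sub>R e)))\<^sup>2)
    \<le> (\<Sum>i\<in>UNIV. \<Sum>k\<in>UNIV. c $ i * c $ k *
          (\<integral>l. (l $ i - \<theta> $ i) * (l $ k - \<theta> $ k) \<partial>outcome_measure M \<rho>))"
proof -
  let ?N = "outcome_measure M \<rho>"
  obtain h :: "nat \<Rightarrow> real^'n \<Rightarrow> real^'n" where h: "\<And>n. simple_function borel (h n)"
      "\<And>l i. (\<lambda>n. h n l $ i) \<longlonglongrightarrow> l $ i - \<theta> $ i"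
      "\<And>n l i. \<bar>h n l $ i\<bar> \<le> 2 * \<bar>l $ i - \<theta> $ i\<bar>"
    using simple_approximation[of \<theta>] by blast
  define \<phi> where "\<phi> v = (\<Sum>i\<in>UNIV. c $ i * v $ i)" for v :: "real^'n"
  define Z where "Z e = (\<Sum>i\<in>UNIV. c $ i *\<^sub>R (uapp (q i) e - \<theta> $ i *\<^sub>R e))" for e
  have sq: "(\<phi> v)\<^sup>2 = (\<Sum>i\<in>UNIV. \<Sum>k\<in>UNIV. c $ i * c $ k * (v $ i * v $ k))" for v
    unfolding \<phi>_def power2_eq_square sum_product by (intro sum.cong refl) (simp add: mult_ac)
  have step: "(\<lambda>n. inner (Z e) (qpm_step M (h n) \<phi> e)) \<longlonglongrightarrow> inner (Z e) (Z e)" if e: "e \<in> F" for e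
  proof -
    have "e \<in> udom (q i)" for i using e F dom by blast
    then have "(\<lambda>n. \<Sum>i\<in>UNIV. c $ i * inner (Z e) (qpm_step M (h n) (\<lambda>v. v $ i) e))
        \<longlonglongrightarrow> (\<Sum>i\<in>UNIV. c $ i * inner (Z e) (uapp (q i) e - \<theta> $ i *\<^sub>R e))"
      by (intro tendsto_sum tendsto_mult_left qpm_step_weak_limit[OF M q _ h])
    moreover have "inner (Z e) (Z e) = (\<Sum>i\<in>UNIV. c $ i * inner (Z e) (uapp (q i) e - \<theta> $ i *\<^sub>R e))"
      by (subst (2) Z_def) (simp add: inner_sum_right)
    moreover have "qpm_step M (h n) \<phi> e = (\<Sum>i\<in>UNIV. c $ i *\<^sub>R qpm_step M (h n) (\<lambda>v. v $ i) e)" for n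
      unfolding \<phi>_def[abs_def] by (rule qpm_step_linear)
    ultimately show ?thesis by (simp add: inner_sum_right)
  qed
  have lim: "(\<lambda>n. \<integral>l. (\<phi> (h n l))\<^sup>2 \<partial>?N) \<longlonglongrightarrow> (\<integral>l. (\<phi> (l - \<theta>))\<^sup>2 \<partial>?N)"
  proof (rule integral_dominated_convergence)
    \<comment> \<open>The integrability hypothesis concerns the pairwise products, so the square of
      \<phi> is dominated pair by pair; 4 is the product of two factors 2 from the bound on
      h.\<close>
    let ?d = "\<lambda>l. \<Sum>i\<in>UNIV. \<Sum>k\<in>UNIV. 4 * \<bar>c $ i * c $ k\<bar> * \<bar>(l $ i - \<theta> $ i) * (l $ k - \<theta> $ k)\<bar>"
    show "integrable ?N ?d"
      by (intro Bochner_Integration.integrable_sum integrable_mult_right integrable_abs int)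
    show "(\<lambda>l. (\<phi> (l - \<theta>))\<^sup>2) \<in> borel_measurable ?N"
      unfolding sq by (intro borel_measurable_integrable Bochner_Integration.integrable_sum
          integrable_mult_right) (simp add: int)
    show "(\<lambda>l. (\<phi> (h n l))\<^sup>2) \<in> borel_measurable ?N" for n
      by (intro borel_measurable_integrable integral_simple_compose(1)
          finite_outcome_measure[OF M \<rho> sd] sets_outcome_measure[OF M \<rho> sd] h)
    show "AE l in ?N. (\<lambda>n. (\<phi> (h n l))\<^sup>2) \<longlonglongrightarrow> (\<phi> (l - \<theta>))\<^sup>2"
      unfolding \<phi>_def by (intro AE_I2 tendsto_power tendsto_sum tendsto_mult_left) (simp add: h)
    show "AE l in ?N. norm ((\<phi> (h n l))\<^sup>2) \<le> ?d l" for n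
    proof (rule AE_I2)
      fix l
      have "norm ((\<phi> (h n l))\<^sup>2) = (\<phi> (h n l))\<^sup>2" by simp
      also have "\<dots> \<le> ?d l"
        unfolding sq
      proof (intro sum_mono)
        fix i k :: 'n
        have "c $ i * c $ k * (h n l $ i * h n l $ k) \<le> \<bar>c $ i * c $ k\<bar> * (\<bar>h n l $ i\<bar> * \<bar>h n l $ k\<bar>)"
          by (metis abs_ge_self abs_mult)
        also have "\<dots> \<le> \<bar>c $ i * c $ k\<bar> * ((2 * \<bar>l $ i - \<theta> $ i\<bar>) * (2 * \<bar>l $ k - \<theta> $ k\<bar>))"
          by (intro mult_left_mono mult_mono h) auto
        finally show "c $ i * c $ k * (h n l $ i * h n l $ k)
            \<le> 4 * \<bar>c $ i * c $ k\<bar> * \<bar>(l $ i - \<theta> $ i) * (l $ k - \<theta> $ k)\<bar>"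
          by (simp add: abs_mult mult_ac)
      qed
      finally show "norm ((\<phi> (h n l))\<^sup>2) \<le> ?d l" .
    qed
  qed
  have "(\<Sum>e\<in>F. w e * (2 * inner (Z e) (qpm_step M (h n) \<phi> e) - inner (Z e) (Z e)))
      \<le> (\<integral>l. (\<phi> (h n l))\<^sup>2 \<partial>?N)" for n
  proof -
    have "2 * inner (Z e) u - inner (Z e) (Z e) \<le> (norm u)\<^sup>2" for e u
      using inner_ge_zero[of "Z e - u"]
      by (simp add: power2_norm_eq_inner inner_diff_left inner_diff_right inner_commute)
    then have "(\<Sum>e\<in>F. w e * (2 * inner (Z e) (qpm_step M (h n) \<phi> e) - inner (Z e) (Z e)))
        \<le> (\<Sum>e\<in>F. w e * (norm (qpm_step M (h n) \<phi> e))\<^sup>2)"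
      using sd F by (intro sum_mono mult_left_mono) (auto simp: spectral_decomp_def intro: less_imp_le)
    also have "\<dots> \<le> (\<integral>l. (\<phi> (h n l))\<^sup>2 \<partial>?N)"
      by (rule qpm_step_outcome_bound[OF M \<rho> sd h(1) F])
    finally show ?thesis .
  qed
  moreover have "(\<lambda>n. \<Sum>e\<in>F. w e * (2 * inner (Z e) (qpm_step M (h n) \<phi> e) - inner (Z e) (Z e)))
      \<longlonglongrightarrow> (\<Sum>e\<in>F. w e * (2 * inner (Z e) (Z e) - inner (Z e) (Z e)))"
    by (intro tendsto_intros step)
  ultimately have "(\<Sum>e\<in>F. w e * (2 * inner (Z e) (Z e) - inner (Z e) (Z e))) \<le> (\<integral>l. (\<phi> (l - \<theta>))\<^sup>2 \<partial>?N)"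
    using lim by (intro LIMSEQ_le) auto
  also have "\<dots> = (\<Sum>i\<in>UNIV. \<Sum>k\<in>UNIV. c $ i * c $ k * (\<integral>l. (l $ i - \<theta> $ i) * (l $ k - \<theta> $ k) \<partial>?N))"
    unfolding sq using int by (simp add: Bochner_Integration.integral_sum)
  finally show ?thesis by (simp add: Z_def power2_norm_eq_inner)
qed

lemma inner_ext_dense:
  fixes a b :: "'h::real_inner"
  assumes "closure D = UNIV" "\<And>z. z \<in> D \<Longrightarrow> inner z a = inner z b"
  shows "a = b"
proof -
  have "a - b \<in> closure D" using assms by auto
  then obtain f where f: "\<And>n. f n \<in> D" "f \<longlonglongrightarrow> a - b" unfolding closure_sequential by blast
  have "(\<lambda>n. inner (f n) (a - b)) \<longlonglongrightarrow> inner (a - b) (a - b)"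
    by (intro tendsto_inner f(2) tendsto_const)
  moreover have "inner (f n) (a - b) = 0" for n using assms(2)[OF f(1)] by (simp add: inner_diff_right)
  ultimately have "inner (a - b) (a - b) = 0" using LIMSEQ_unique[OF _ tendsto_const] by fastforce
  then show ?thesis by simp
qed

section \<open>The derivative of the state as a commutator\<close>

lemma partial_op_has_vector_derivative:
  assumes "smooth_family \<Theta> \<rho>" "\<theta> \<in> \<Theta>"
  shows "((\<lambda>t. \<rho> (\<theta> + t *\<^sub>R axis k 1) x) has_vector_derivative partial_op k \<rho> \<theta> x) (at 0)"
proof -
  have "Ck_on (Suc 0) \<Theta> (\<lambda>\<theta>. \<rho> \<theta> x)" using assms(1) unfolding smooth_family_def by blast
  then obtain f' where "((\<lambda>t. \<rho> (\<theta> + t *\<^sub>R axis k 1) x) has_vector_derivative f' k \<theta>) (at 0)"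
    using assms(2) by auto
  then show ?thesis unfolding partial_op_def by (simp add: vector_derivative_at)
qed

lemma open_line_preimage:
  fixes \<Theta> :: "'a::real_normed_vector set"
  assumes "open \<Theta>"
  shows "open {t::real. \<theta> + t *\<^sub>R v \<in> \<Theta>}"
proof -
  have "open ((\<lambda>t::real. \<theta> + t *\<^sub>R v) -` \<Theta>)"
    by (rule open_vimage[OF assms]) (intro continuous_intros)
  then show ?thesis by (simp add: vimage_def)
qed

text \<open>Both sides are derivatives at 0 of functions that agree near 0, because \<Theta> is open
  and the states are symmetric. This symmetry is what later extends an identity for the derivative
  from a dense domain to the whole space.\<close>

lemma partial_op_symmetric:
  fixes \<rho> :: "real^'n \<Rightarrow> 'h::complex_hilbert \<Rightarrow> 'h"
  assumes \<Theta>: "open \<Theta>" "\<theta> \<in> \<Theta>" and smooth: "smooth_family \<Theta> \<rho>"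
    and pos: "\<And>\<theta>. \<theta> \<in> \<Theta> \<Longrightarrow> positive_op (\<rho> \<theta>)"
  shows "inner y (partial_op k \<rho> \<theta> x) = inner x (partial_op k \<rho> \<theta> y)"
proof (rule vector_derivative_unique_at)
  have deriv: "((\<lambda>t. inner b (\<rho> (\<theta> + t *\<^sub>R axis k 1) a)) has_vector_derivative
      inner b (partial_op k \<rho> \<theta> a)) (at 0)" for a b
    by (rule bounded_linear.has_vector_derivative[OF bounded_linear_inner_right
          partial_op_has_vector_derivative[OF smooth \<Theta>(2)]])
  show "((\<lambda>t. inner y (\<rho> (\<theta> + t *\<^sub>R axis k 1) x)) has_vector_derivative
      inner y (partial_op k \<rho> \<theta> x)) (at 0)" by (rule deriv)
  show "((\<lambda>t. inner y (\<rho> (\<theta> + t *\<^sub>R axis k 1) x)) has_vector_derivative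
      inner x (partial_op k \<rho> \<theta> y)) (at 0)"
  proof (rule has_vector_derivative_transform_within_open[OF deriv open_line_preimage[OF \<Theta>(1)]])
    show "0 \<in> {t. \<theta> + t *\<^sub>R axis k 1 \<in> \<Theta>}" using \<Theta> by simp
    show "inner x (\<rho> (\<theta> + t *\<^sub>R axis k 1) y) = inner y (\<rho> (\<theta> + t *\<^sub>R axis k 1) x)"
      if "t \<in> {t. \<theta> + t *\<^sub>R axis k 1 \<in> \<Theta>}" for t
      using that by (intro positive_op_symmetric pos) simp
  qed
qed

text \<open>On the open set \<Theta> the function is the i-th coordinate, whose derivative along
  axis k is the Kronecker delta \<open>axis k 1 $ i\<close>; uniqueness of derivatives does the
  rest.\<close>

lemma unbiased_derivative:
  fixes \<theta> :: "real^'n"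
  assumes \<Theta>: "open \<Theta>" "\<theta> \<in> \<Theta>" and f: "\<And>\<theta>. \<theta> \<in> \<Theta> \<Longrightarrow> f \<theta> = complex_of_real (\<theta> $ i)"
    and d: "((\<lambda>t. f (\<theta> + t *\<^sub>R axis k 1)) has_vector_derivative d) (at 0)"
  shows "d = of_real (axis k 1 $ i)"
proof (rule vector_derivative_unique_at[OF d])
  show "((\<lambda>t. f (\<theta> + t *\<^sub>R axis k 1)) has_vector_derivative of_real (axis k 1 $ i)) (at 0)"
  proof (rule has_vector_derivative_transform_within_open[OF _ open_line_preimage[OF \<Theta>(1)]])
    have "((\<lambda>t. \<theta> $ i + t * axis k 1 $ i) has_vector_derivative axis k 1 $ i) (at 0)"
      by (auto intro!: derivative_eq_intros)
    then show "((\<lambda>t. complex_of_real ((\<theta> + t *\<^sub>R axis k 1) $ i)) has_vector_derivative of_real (axis k 1 $ i)) (at 0)"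
      using bounded_linear.has_vector_derivative[OF bounded_linear_of_real] by fastforce
    show "0 \<in> {t. \<theta> + t *\<^sub>R axis k 1 \<in> \<Theta>}" using \<Theta> by simp
  qed (simp add: f)
qed

section \<open>Rank-one form of the commutator and its trace\<close>

lemma weighted_product_summable:
  fixes w :: "'i \<Rightarrow> real"
  assumes w: "\<And>e. e \<in> E \<Longrightarrow> 0 \<le> w e"
    and f: "(\<lambda>e. w e * (f e)\<^sup>2) summable_on E" and g: "(\<lambda>e. w e * (g e)\<^sup>2) summable_on E"
    and nn: "\<And>e. 0 \<le> f e" "\<And>e. 0 \<le> g e"
  shows "(\<lambda>e. w e * (f e * g e)) summable_on E"
proof (rule summable_on_comparison_test)
  show "(\<lambda>e. w e * (f e)\<^sup>2 + w e * (g e)\<^sup>2) summable_on E" by (rule summable_on_add[OF f g])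
  show "w e * (f e * g e) \<le> w e * (f e)\<^sup>2 + w e * (g e)\<^sup>2" if "e \<in> E" for e
  proof -
    have "f e * g e \<le> (f e)\<^sup>2 + (g e)\<^sup>2"
      using sum_squares_bound[of "f e" "g e"] nn[of e] mult_nonneg_nonneg[of "f e" "g e"] by linarith
    then show ?thesis using mult_left_mono[OF _ w[OF that]] by (simp add: distrib_left[symmetric])
  qed
qed (use w nn in simp)

text \<open>On the domain of p the operator \<rho> p is the sum of |w_e e><p e| and p \<rho> is its
  adjoint. The conclusion holds for every x, which matters because G will be evaluated at q u, a
  vector that need not lie in the domain of p.\<close>

lemma commutator_rank_one_sum:
  fixes \<rho> G :: "'h::complex_hilbert \<Rightarrow> 'h"
  assumes \<rho>: "positive_op \<rho>" and sd: "spectral_decomp \<rho> E w"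
    and p: "hermitian_op p" "E \<subseteq> udom p"
    and s: "(\<lambda>e. norm (w e *\<^sub>R e) * norm (uapp p e)) summable_on E"
    and G: "\<And>x y. inner y (G x) = inner x (G y)"
    and comm: "\<And>x. x \<in> udom p \<Longrightarrow>
      \<rho> x \<in> udom p \<and> \<rho> (uapp p x) - uapp p (\<rho> x) = (of_real hbar / \<i>) *\<^sub>C G x"
    and hbar: "hbar > 0"
  shows "(of_real hbar / \<i>) *\<^sub>C G x =
    rank_one_sum E (\<lambda>e. w e *\<^sub>R e) (uapp p) x - rank_one_sum E (uapp p) (\<lambda>e. w e *\<^sub>R e) x"
proof -
  let ?L = "rank_one_sum E (\<lambda>e. w e *\<^sub>R e) (uapp p)" and ?L' = "rank_one_sum E (uapp p) (\<lambda>e. w e *\<^sub>R e)"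
  have s': "(\<lambda>e. norm (uapp p e) * norm (w e *\<^sub>R e)) summable_on E" using s by (simp add: mult.commute)
  have dense: "closure (udom p) = UNIV"
    and sym: "\<And>x y. x \<in> udom p \<Longrightarrow> y \<in> udom p \<Longrightarrow> cinner (uapp p x) y = cinner x (uapp p y)"
    using p(1) unfolding hermitian_op_def by blast+
  have L: "\<rho> (uapp p x) = ?L x" if x: "x \<in> udom p" for x
  proof -
    have "((\<lambda>e. (of_real (w e) * cinner e (uapp p x)) *\<^sub>C e) has_sum \<rho> (uapp p x)) E"
      using sd unfolding spectral_decomp_def by blast
    moreover have "(of_real (w e) * cinner e (uapp p x)) *\<^sub>C e = cinner (uapp p e) x *\<^sub>C (w e *\<^sub>R e)"
      if "e \<in> E" for e
      using sym[OF _ x, of e] p(2) that by (auto simp: scaleC_of_real[symmetric] scaleC_scaleC mult.commute)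
    ultimately have "((\<lambda>e. cinner (uapp p e) x *\<^sub>C (w e *\<^sub>R e)) has_sum \<rho> (uapp p x)) E"
      by (simp cong: has_sum_cong)
    then show ?thesis by (rule has_sum_unique) (rule rank_one_has_sum[OF s])
  qed
  \<comment> \<open>Closedness of p is not assumed, so p is not applied to the series termwise;
    instead p and then \<rho> are moved onto a test vector from the dense domain.\<close>
  have L': "uapp p (\<rho> x) = ?L' x" if x: "x \<in> udom p" for x
  proof (rule inner_ext_dense[OF dense])
    fix z assume z: "z \<in> udom p"
    have "cinner z (uapp p (\<rho> x)) = cinner (uapp p z) (\<rho> x)" using sym[OF z] comm[OF x] by simp
    also have "\<dots> = cinner (?L z) x" using positive_op_adjoint[OF \<rho>] L[OF z] by metis
    also have "\<dots> = cinner z (?L' x)" by (rule rank_one_adjoint[OF s', symmetric])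
    finally show "inner z (uapp p (\<rho> x)) = inner z (?L' x)" by (metis Re_cinner)
  qed
  define K where "K x = (\<i> / of_real hbar) *\<^sub>C (?L x - ?L' x)" for x
  have K: "G x = K x" if "x \<in> udom p" for x
  proof -
    have "(\<i> / of_real hbar) *\<^sub>C ((of_real hbar / \<i>) *\<^sub>C G x) = K x"
      using comm[OF that] L[OF that] L'[OF that] unfolding K_def by simp
    then show ?thesis using hbar by (simp add: scaleC_scaleC scaleC_one)
  qed
  \<comment> \<open>Taking adjoints exchanges \<open>?L\<close> and \<open>?L'\<close>, and
    conjugation of the factor i restores the sign.\<close>
  have Kadj: "cinner y (K x) = cinner (K y) x" for x y
    using hbar unfolding K_def
    by (simp add: cinner_scaleC_left cinner_scaleC_right cinner_diff_left cinner_diff_right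
        rank_one_adjoint[OF s, of y x] rank_one_adjoint[OF s', of y x] algebra_simps)
  \<comment> \<open>For a test vector y in the domain, G moves onto y by symmetry, equals K there,
    and moves back by self-adjointness of K.\<close>
  have "G x = K x"
  proof (rule inner_ext_dense[OF dense])
    fix y assume y: "y \<in> udom p"
    have "inner y (G x) = inner x (K y)" using G[of y x] K[OF y] by simp
    also have "\<dots> = inner y (K x)" using Kadj[of y x] by (metis Re_cinner inner_commute)
    finally show "inner y (G x) = inner y (K x)" .
  qed
  then show ?thesis using hbar by (simp add: K_def scaleC_scaleC scaleC_one)
qed

lemma has_trace_add:
  assumes "has_trace S s" "has_trace T t"
  shows "has_trace (\<lambda>x. S x + T x) (s + t)"
  using assms unfolding has_trace_def bounded_clinear_def
  by (auto intro!: bounded_linear_add has_sum_add simp: scaleC_add_right cinner_add_right)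

lemma has_trace_scaleC:
  assumes "has_trace T t"
  shows "has_trace (\<lambda>x. c *\<^sub>C T x) (c * t)"
  using assms unfolding has_trace_def bounded_clinear_def
  by (auto intro!: bounded_linear_compose[OF bounded_linear_scaleC_right] has_sum_cmult_right
      simp: scaleC_scaleC cinner_scaleC_right mult.commute)

text \<open>The commutator splits \<open>D\<close> on \<open>udom q\<close> into two terms. The first is not obviously bounded there,
  because \<open>p e\<close> need not lie in \<open>udom q\<close>; the second has a trace-class extension, hence so does the
  first, called \<open>F\<close>. As \<open>\<langle>b, F x\<rangle> = 0\<close> for \<open>b\<close> orthogonal to \<open>E\<close>, a basis containing \<open>E\<close> reads off
  the trace of \<open>F\<close>.\<close>

lemma commutator_trace:
  fixes D G :: "'h::complex_hilbert \<Rightarrow> 'h"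
  assumes E: "corthonormal E" and p: "E \<subseteq> udom p" and q: "hermitian_op q" "E \<subseteq> udom q"
    and s: "(\<lambda>e. norm (w e *\<^sub>R e) * norm (uapp p e)) summable_on E"
    and s2: "(\<lambda>e. norm (uapp p e) * norm (w e *\<^sub>R uapp q e)) summable_on E"
    and G: "\<And>x. (of_real hbar / \<i>) *\<^sub>C G x =
      rank_one_sum E (\<lambda>e. w e *\<^sub>R e) (uapp p) x - rank_one_sum E (uapp p) (\<lambda>e. w e *\<^sub>R e) x"
    and D: "has_trace D d" "\<And>u. u \<in> udom q \<Longrightarrow> D u = G (uapp q u)"
  shows "((\<lambda>e. of_real (w e) * cinner (uapp p e) (uapp q e)) has_sum
    (of_real hbar / \<i>) * d + (\<Sum>\<^sub>\<infinity>e\<in>E. cinner (w e *\<^sub>R uapp q e) (uapp p e))) E"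
proof -
  let ?L = "rank_one_sum E (\<lambda>e. w e *\<^sub>R e) (uapp p)" and ?L' = "rank_one_sum E (uapp p) (\<lambda>e. w e *\<^sub>R e)"
  let ?R = "rank_one_sum E (uapp p) (\<lambda>e. w e *\<^sub>R uapp q e)"
  define F where "F x = (of_real hbar / \<i>) *\<^sub>C D x + ?R x" for x
  let ?t = "(of_real hbar / \<i>) * d + (\<Sum>\<^sub>\<infinity>e\<in>E. cinner (w e *\<^sub>R uapp q e) (uapp p e))"
  have s': "(\<lambda>e. norm (uapp p e) * norm (w e *\<^sub>R e)) summable_on E" using s by (simp add: mult.commute)
  have F: "has_trace F ?t"
    unfolding F_def by (rule has_trace_add[OF has_trace_scaleC[OF D(1)] rank_one_has_trace(2)[OF s2]])
  have dense: "closure (udom q) = UNIV"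
    and sym: "\<And>x y. x \<in> udom q \<Longrightarrow> y \<in> udom q \<Longrightarrow> cinner (uapp q x) y = cinner x (uapp q y)"
    using q(1) unfolding hermitian_op_def by blast+
  have Fq: "F u = ?L (uapp q u)" if u: "u \<in> udom q" for u
  proof -
    \<comment> \<open>Moving q onto the eigenvector leaves an expression that makes sense for every
      u; this is the trace-class extension \<open>?R\<close>.\<close>
    have "cinner (w e *\<^sub>R e) (uapp q u) *\<^sub>C uapp p e = cinner (w e *\<^sub>R uapp q e) u *\<^sub>C uapp p e" if "e \<in> E" for e
      using sym[OF _ u, of e] q(2) that by (auto simp: cinner_scaleR_left)
    then have "?L' (uapp q u) = ?R u" unfolding rank_one_sum_def by (intro infsum_cong)
    then show ?thesis using G[of "uapp q u"] unfolding F_def D(2)[OF u] by simp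
  qed
  obtain B where B: "E \<subseteq> B" "conb B" using corthonormal_extends_conb[OF E] .
  have on: "corthonormal B" using B unfolding conb_def by simp
  have L'_B: "?L' b = (if b \<in> E then w b *\<^sub>R uapp p b else 0)" if b: "b \<in> B" for b
  proof -
    have e: "cinner (w e *\<^sub>R e) b = (if e = b then of_real (w e) else 0)" if "e \<in> E" for e
      using on b that B(1) unfolding corthonormal_def by (auto simp: cinner_scaleR_left)
    have "((\<lambda>e. cinner (w e *\<^sub>R e) b *\<^sub>C uapp p e) has_sum (if b \<in> E then w b *\<^sub>R uapp p b else 0)) E"
    proof (cases "b \<in> E")
      case True
      then show ?thesis
        by (intro has_sum_finite_neutralI[of "{b}"]) (auto simp: e scaleC_of_real scaleC_zero_left)
    next
      case False
      then have "cinner (w e *\<^sub>R e) b *\<^sub>C uapp p e = 0" if "e \<in> E" for e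
        using that by (auto simp: e scaleC_zero_left)
      then show ?thesis using False by (simp add: has_sum_0)
    qed
    then show ?thesis by (rule has_sum_unique[OF rank_one_has_sum[OF s']])
  qed
  have hs: "((\<lambda>b. cinner b (F b)) has_sum ?t) B" using F B unfolding has_trace_def by simp
  have el: "cinner b (F b) = of_real (w b) * cinner (uapp p b) (uapp q b)" if "b \<in> E" for b
  proof -
    have b: "b \<in> udom q" "b \<in> B" using that q(2) B(1) by auto
    have "cinner b (F b) = cinner (?L' b) (uapp q b)"
      unfolding Fq[OF b(1)] by (rule rank_one_adjoint[OF s])
    then show ?thesis using that by (simp add: L'_B[OF b(2)] cinner_scaleR_left)
  qed
  have off: "cinner b (F b) = 0" if b: "b \<in> B - E" for b
  proof -
    \<comment> \<open>The vector b may lie outside the domain of q, where F is not given by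
      \<open>?L\<close>; continuity of F carries the vanishing over.\<close>
    have "b \<in> closure (udom q)" using dense by simp
    then obtain f where f: "\<And>n. f n \<in> udom q" "f \<longlonglongrightarrow> b" unfolding closure_sequential by blast
    have "cinner b (F (f n)) = 0" for n
      unfolding Fq[OF f(1)] rank_one_adjoint[OF s] using b by (simp add: L'_B)
    moreover have "(\<lambda>n. cinner b (F (f n))) \<longlonglongrightarrow> cinner b (F b)"
      using F unfolding has_trace_def bounded_clinear_def
      by (intro bounded_linear.tendsto[OF bounded_linear_cinner_right] bounded_linear.tendsto[OF _ f(2)]) simp
    ultimately show ?thesis by (simp add: LIMSEQ_const_iff)
  qed
  have "((\<lambda>e. of_real (w e) * cinner (uapp p e) (uapp q e)) has_sum ?t) E
      \<longleftrightarrow> ((\<lambda>b. cinner b (F b)) has_sum ?t) B"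
    by (rule has_sum_cong_neutral) (use B(1) in \<open>auto simp: el off\<close>)
  then show ?thesis using hs by (rule iffD2)
qed

section \<open>The matrix inequalities\<close>

lemma has_sum_sum:
  fixes f :: "'i \<Rightarrow> 'a \<Rightarrow> 'b::topological_comm_monoid_add"
  assumes "\<And>i. i \<in> I \<Longrightarrow> (f i has_sum s i) A"
  shows "((\<lambda>x. \<Sum>i\<in>I. f i x) has_sum (\<Sum>i\<in>I. s i)) A"
  using assms by (induction I rule: infinite_finite_induct) (auto intro!: has_sum_add has_sum_0)

text \<open>The matrix A is a weighted Gram matrix, so its form at a real vector is a weighted sum
  of squared norms and is real even when single entries are not. It is applied both to the centred
  q_i and to the p_k.\<close>

lemma gram_form_has_sum:
  fixes c :: "'n::finite \<Rightarrow> real" and v :: "'n \<Rightarrow> 'i \<Rightarrow> 'h::complex_hilbert"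
  assumes "\<And>i k. ((\<lambda>e. of_real (w e) * cinner (v i e) (v k e)) has_sum A i k) E"
  shows "((\<lambda>e. w e * (norm (\<Sum>i\<in>UNIV. c i *\<^sub>R v i e))\<^sup>2) has_sum
      Re (\<Sum>i\<in>UNIV. \<Sum>k\<in>UNIV. A i k * of_real (c i) * of_real (c k))) E"
    and "(\<Sum>i\<in>UNIV. \<Sum>k\<in>UNIV. A i k * of_real (c i) * of_real (c k)) \<in> \<real>"
proof -
  let ?s = "\<Sum>i\<in>UNIV. \<Sum>k\<in>UNIV. A i k * of_real (c i) * of_real (c k)"
  have "of_real (w e) * (\<Sum>i\<in>UNIV. \<Sum>k\<in>UNIV. cinner (v i e) (v k e) * of_real (c i) * of_real (c k))
      = of_real (w e * (norm (\<Sum>i\<in>UNIV. c i *\<^sub>R v i e))\<^sup>2)" for e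
    unfolding of_real_mult cinner_self[symmetric] cinner_sum_left
    unfolding cinner_sum_right cinner_scaleR_left cinner_scaleR_right
    by (rule arg_cong2[where f = "(*)", OF refl]) (intro sum.cong refl, simp add: sum_distrib_left mult_ac)
  moreover have "((\<lambda>e. \<Sum>i\<in>UNIV. \<Sum>k\<in>UNIV. of_real (w e) * cinner (v i e) (v k e) * of_real (c i) * of_real (c k)) has_sum ?s) E"
    by (intro has_sum_sum has_sum_cmult_left assms)
  ultimately have s: "((\<lambda>e. of_real (w e * (norm (\<Sum>i\<in>UNIV. c i *\<^sub>R v i e))\<^sup>2)) has_sum ?s) E"
    by (simp add: sum_distrib_left mult.assoc)
  from has_sum_Re[OF s] show "((\<lambda>e. w e * (norm (\<Sum>i\<in>UNIV. c i *\<^sub>R v i e))\<^sup>2) has_sum Re ?s) E" by simp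
  have "((\<lambda>e. 0) has_sum Im ?s) E" using has_sum_Im[OF s] by simp
  then have "Im ?s = 0" by (rule has_sum_unique) (rule has_sum_0, simp)
  then show "?s \<in> \<real>" by (simp add: complex_is_Real_iff)
qed

text \<open>The entries of S have complex type but real values. The imaginary part of the solution
  of S z = c is then annihilated by S, and invertibility makes it zero.\<close>

lemma real_matrix_inv_solution:
  fixes S :: "complex^'n^'n" and c :: "real^'n"
  assumes S: "invertible S" and real: "\<And>i k. S $ i $ k \<in> \<real>"
  obtains d :: "real^'n"
  where "\<And>i. (\<Sum>k\<in>UNIV. matrix_inv S $ i $ k * of_real (c $ k)) = of_real (d $ i)"
    and "\<And>i. (\<Sum>k\<in>UNIV. S $ i $ k * of_real (d $ k)) = of_real (c $ i)"
proof -
  define cc where "cc = (\<chi> i. complex_of_real (c $ i))"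
  define z where "z = matrix_inv S *v cc"
  have inv: "S ** matrix_inv S = mat 1" "matrix_inv S ** S = mat 1"
    using someI_ex[OF S[unfolded invertible_def]] unfolding matrix_inv_def by simp_all
  have Sz: "S *v z = cc" unfolding z_def by (simp add: matrix_vector_mul_assoc inv)
  define y where "y = (\<chi> i. complex_of_real (Im (z $ i)))"
  have "S *v y = 0"
    unfolding vec_eq_iff
  proof
    fix i
    have "S $ i $ k * of_real (Im (z $ k)) = of_real (Im (S $ i $ k * z $ k))" for k
      using real[of i k] by (simp add: complex_is_Real_iff complex_eq_iff)
    then have "(S *v y) $ i = of_real (Im ((S *v z) $ i))"
      by (simp only: matrix_vector_mult_def y_def vec_lambda_beta Im_sum of_real_sum)
    then show "(S *v y) $ i = 0 $ i" by (simp add: Sz cc_def)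
  qed
  then have "y = 0" using inv(2) by (metis matrix_vector_mul_assoc matrix_vector_mul_lid matrix_vector_mult_0_right)
  then have z: "z $ i = of_real (Re (z $ i))" for i by (simp add: y_def vec_eq_iff complex_eq_iff)
  show ?thesis
  proof (rule that[of "\<chi> i. Re (z $ i)"])
    show "(\<Sum>k\<in>UNIV. matrix_inv S $ i $ k * of_real (c $ k)) = of_real ((\<chi> i. Re (z $ i)) $ i)" for i
      using z[of i] by (simp add: z_def cc_def matrix_vector_mult_def)
    show "(\<Sum>k\<in>UNIV. S $ i $ k * of_real ((\<chi> i. Re (z $ i)) $ k)) = of_real (c $ i)" for i
      using arg_cong[OF Sz, of "\<lambda>v. v $ i"] by (simp add: cc_def matrix_vector_mult_def flip: z)
  qed
qed

section \<open>From the commutator to the cross-covariance of p and q\<close>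

lemma Im_cinner_hermitian:
  assumes "hermitian_op X" "x \<in> udom X"
  shows "Im (cinner (uapp X x) x) = 0"
proof -
  have "cinner (uapp X x) x = cinner x (uapp X x)" using assms unfolding hermitian_op_def by simp
  then have "Im (cinner (uapp X x) x) = - Im (cinner (uapp X x) x)" by (metis cinner_commute cnj.sel(2))
  then show ?thesis by simp
qed

text \<open>By Cauchy-Schwarz the expression is at least (|z| - (hbar/2) |y|)^2.\<close>

lemma uncertainty_termwise:
  fixes y z :: "'h::complex_hilbert"
  assumes "0 \<le> hbar"
  shows "0 \<le> (norm z)\<^sup>2 + hbar * Im (cinner y z) + hbar\<^sup>2 / 4 * (norm y)\<^sup>2"
proof -
  have "- (norm y * norm z) \<le> Im (cinner y z)"
    using abs_Im_le_cmod[of "cinner y z"] cinner_Cauchy_Schwarz[of y z] by linarith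
  then have "hbar * - (norm y * norm z) \<le> hbar * Im (cinner y z)" by (rule mult_left_mono) (rule assms)
  moreover have "0 \<le> (norm z - hbar / 2 * norm y)\<^sup>2" by simp
  ultimately show ?thesis by (simp add: power2_diff power_mult_distrib power_divide algebra_simps)
qed

lemma state_trace_norm_summable:
  assumes "((\<lambda>e. of_real (w e) * cinner (v e) (v e)) has_sum t) E"
  shows "(\<lambda>e. w e * (norm (v e))\<^sup>2) summable_on E"
proof -
  have "((\<lambda>e. of_real (w e * (norm (v e))\<^sup>2)) has_sum t) E" using assms by (simp add: cinner_self)
  from has_sum_imp_summable[OF has_sum_Re[OF this]] show ?thesis by simp
qed

text \<open>With B the sum of w_e <p e, q e>, the trace formula reads B = (hbar/i) d + cnj B. Hence
  2i Im B = -i hbar d, which is the origin of the factor hbar/2.\<close>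

lemma unbiased_commutator_sum:
  fixes D G :: "'h::complex_hilbert \<Rightarrow> 'h"
  assumes \<rho>: "density_operator \<rho>" and sd: "spectral_decomp \<rho> E w"
    and p: "hermitian_op p" "E \<subseteq> udom p" "(\<lambda>e. w e * (norm (uapp p e))\<^sup>2) summable_on E"
    and q: "hermitian_op q" "E \<subseteq> udom q" "(\<lambda>e. w e * (norm (uapp q e - a *\<^sub>R e))\<^sup>2) summable_on E"
    and G: "\<And>x y. inner y (G x) = inner x (G y)"
    and comm: "\<And>x. x \<in> udom p \<Longrightarrow>
      \<rho> x \<in> udom p \<and> \<rho> (uapp p x) - uapp p (\<rho> x) = (of_real hbar / \<i>) *\<^sub>C G x"
    and hbar: "hbar > 0"
    and D: "has_trace D (of_real d)" "\<And>u. u \<in> udom q \<Longrightarrow> D u = G (uapp q u)"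
  shows "((\<lambda>e. w e * Im (cinner (uapp p e) (uapp q e - a *\<^sub>R e))) has_sum (- (hbar / 2) * d)) E"
proof -
  have on: "corthonormal E" and w: "\<And>e. e \<in> E \<Longrightarrow> 0 < w e" using sd unfolding spectral_decomp_def by simp_all
  have ne: "norm e = 1" if "e \<in> E" for e by (rule corthonormal_norm[OF on that])
  have sw: "w summable_on E" by (rule spectral_weights_summable[OF \<rho> sd])
  \<comment> \<open>Square-summability is given for the centred operator; the shift costs 2 a^2 w_e,
    summable because \<rho> has trace 1.\<close>
  have q2: "(\<lambda>e. w e * (norm (uapp q e))\<^sup>2) summable_on E"
  proof (rule summable_on_comparison_test)
    show "(\<lambda>e. 2 * (w e * (norm (uapp q e - a *\<^sub>R e))\<^sup>2) + 2 * a\<^sup>2 * w e) summable_on E"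
      by (intro summable_on_add summable_on_cmult_right q(3) sw)
    show "w e * (norm (uapp q e))\<^sup>2 \<le> 2 * (w e * (norm (uapp q e - a *\<^sub>R e))\<^sup>2) + 2 * a\<^sup>2 * w e"
      if e: "e \<in> E" for e
    proof -
      have "norm (uapp q e) \<le> norm (uapp q e - a *\<^sub>R e) + \<bar>a\<bar>"
        using norm_triangle_ineq[of "uapp q e - a *\<^sub>R e" "a *\<^sub>R e"] ne[OF e] by simp
      then have "(norm (uapp q e))\<^sup>2 \<le> (norm (uapp q e - a *\<^sub>R e) + \<bar>a\<bar>)\<^sup>2" by (rule power_mono) simp
      also have "\<dots> \<le> 2 * (norm (uapp q e - a *\<^sub>R e))\<^sup>2 + 2 * a\<^sup>2"
        using sum_squares_bound[of "norm (uapp q e - a *\<^sub>R e)" "\<bar>a\<bar>"] by (simp add: power2_sum)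
      finally have "w e * (norm (uapp q e))\<^sup>2 \<le> w e * (2 * (norm (uapp q e - a *\<^sub>R e))\<^sup>2 + 2 * a\<^sup>2)"
        using w[OF e] by (intro mult_left_mono) auto
      then show ?thesis by (simp add: algebra_simps)
    qed
  qed (use w in \<open>simp add: less_imp_le\<close>)
  \<comment> \<open>The unit vectors e act as the second square-summable family, again because the
    weights are summable.\<close>
  have "(\<lambda>e. w e * (norm (uapp p e) * norm e)) summable_on E"
    using sw w ne by (intro weighted_product_summable p(3)) (auto intro: less_imp_le cong: summable_on_cong)
  then have s: "(\<lambda>e. norm (w e *\<^sub>R e) * norm (uapp p e)) summable_on E"
    by (rule summable_on_cong[THEN iffD1, rotated]) (use w in \<open>auto simp: less_imp_le mult_ac abs_of_pos\<close>)
  have "(\<lambda>e. w e * (norm (uapp p e) * norm (uapp q e))) summable_on E"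
    using w by (intro weighted_product_summable p(3) q2) (auto intro: less_imp_le)
  then have s2: "(\<lambda>e. norm (uapp p e) * norm (w e *\<^sub>R uapp q e)) summable_on E"
    by (rule summable_on_cong[THEN iffD1, rotated]) (use w in \<open>auto simp: mult_ac abs_of_pos\<close>)
  have pos: "positive_op \<rho>" using \<rho> unfolding density_operator_def by simp
  let ?A = "\<Sum>\<^sub>\<infinity>e\<in>E. cinner (w e *\<^sub>R uapp q e) (uapp p e)"
  let ?B = "(of_real hbar / \<i>) * of_real d + ?A"
  have B: "((\<lambda>e. of_real (w e) * cinner (uapp p e) (uapp q e)) has_sum ?B) E"
    by (rule commutator_trace[OF on p(2) q(1,2) s s2 _ D])
       (rule commutator_rank_one_sum[OF pos sd p(1,2) s G comm hbar])
  have "((\<lambda>e. cnj (of_real (w e) * cinner (uapp p e) (uapp q e))) has_sum cnj ?B) E"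
    using B by (simp only: has_sum_cnj_iff)
  moreover have "cnj (of_real (w e) * cinner (uapp p e) (uapp q e)) = cinner (w e *\<^sub>R uapp q e) (uapp p e)" for e
    by (simp add: cinner_scaleR_left cinner_commute[of "uapp q e" "uapp p e"])
  ultimately have "((\<lambda>e. cinner (w e *\<^sub>R uapp q e) (uapp p e)) has_sum cnj ?B) E" by (simp only:)
  then have "?A = cnj ?B" by (rule has_sum_unique[OF rank_one_has_trace(1)[OF s2]])
  then have "Im ?A = - Im ?B" by (metis cnj.sel(2))
  then have ImB: "Im ?B = - (hbar / 2) * d" by simp
  \<comment> \<open>Centring leaves the imaginary part unchanged: a is real, and so is <p e, e> for
    Hermitian p.\<close>
  have eq: "Im (of_real (w e) * cinner (uapp p e) (uapp q e)) = w e * Im (cinner (uapp p e) (uapp q e - a *\<^sub>R e))"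
    if "e \<in> E" for e
    using Im_cinner_hermitian[OF p(1), of e] p(2) that
    by (auto simp: cinner_diff_right cinner_scaleR_right)
  from has_sum_Im[OF B] show ?thesis
    unfolding ImB by (rule has_sum_cong[THEN iffD1, rotated]) (rule eq)
qed

theorem mainTheorem3:
  fixes \<rho> :: "real^'n \<Rightarrow> 'h::complex_hilbert \<Rightarrow> 'h"
    and \<Theta> :: "(real^'n) set"
    and p :: "real^'n \<Rightarrow> 'n \<Rightarrow> 'h uop"
    and M :: "(real^'n) set \<Rightarrow> 'h \<Rightarrow> 'h"
    and q :: "'n \<Rightarrow> 'h uop"
    and hbar :: real
  assumes hbar: "hbar > 0"
    and open_\<Theta>: "open \<Theta>"
    and density: "\<And>\<theta>. \<theta> \<in> \<Theta> \<Longrightarrow> density_operator (\<rho> \<theta>)"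
    and smooth: "smooth_family \<Theta> \<rho>"
    and herm_p: "\<And>\<theta> k. \<theta> \<in> \<Theta> \<Longrightarrow> hermitian_op (p \<theta> k)"
    and commutator: "\<And>\<theta> k x. \<theta> \<in> \<Theta> \<Longrightarrow> x \<in> udom (p \<theta> k) \<Longrightarrow>
          \<rho> \<theta> x \<in> udom (p \<theta> k) \<and>
          \<rho> \<theta> (uapp (p \<theta> k) x) - uapp (p \<theta> k) (\<rho> \<theta> x) =
            (of_real hbar / \<i>) *\<^sub>C partial_op k \<rho> \<theta> x"
    and S_finite: "\<And>\<theta> i k. \<theta> \<in> \<Theta> \<Longrightarrow> \<exists>t. has_state_trace (\<rho> \<theta>) (p \<theta> i) (p \<theta> k) t"
    and S_nondegenerate: "\<And>\<theta>. \<theta> \<in> \<Theta> \<Longrightarrow> invertible (S_matrix (\<rho> \<theta>) (p \<theta>))"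
    and qpm: "quantum_prob_measure M"
    and q_integral: "\<And>i. is_qpm_integral M (\<lambda>l. l $ i) (q i)"
    and unbiased: "\<And>\<theta> i. \<theta> \<in> \<Theta> \<Longrightarrow> has_op_trace (lmult_op (\<rho> \<theta>) (q i)) (of_real (\<theta> $ i))"
    and interchange: "\<And>\<theta> i k. \<theta> \<in> \<Theta> \<Longrightarrow>
          \<exists>d. has_op_trace (lmult_op (partial_op k \<rho> \<theta>) (q i)) d \<and>
            ((\<lambda>t. op_Tr (lmult_op (\<rho> (\<theta> + t *\<^sub>R axis k 1)) (q i))) has_vector_derivative d) (at 0)"
    and R_finite: "\<And>\<theta> i k. \<theta> \<in> \<Theta> \<Longrightarrow>
          integrable (outcome_measure M (\<rho> \<theta>)) (\<lambda>l. (l $ i - \<theta> $ i) * (l $ k - \<theta> $ k))"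
    and Q_finite: "\<And>\<theta> i k. \<theta> \<in> \<Theta> \<Longrightarrow>
          \<exists>t. has_state_trace (\<rho> \<theta>) (shift_op (q i) (\<theta> $ i)) (shift_op (q k) (\<theta> $ k)) t"
  shows "\<forall>\<theta>\<in>\<Theta>. matrix_ge (R_matrix (\<rho> \<theta>) M \<theta>) (Q_matrix (\<rho> \<theta>) q \<theta>) \<and>
    matrix_ge (Q_matrix (\<rho> \<theta>) q \<theta>) ((hbar\<^sup>2 / 4) *\<^sub>R matrix_inv (S_matrix (\<rho> \<theta>) (p \<theta>)))"
proof (rule ballI)
  fix \<theta> assume \<theta>: "\<theta> \<in> \<Theta>"
  let ?\<rho> = "\<rho> \<theta>" and ?N = "outcome_measure M (\<rho> \<theta>)"
  let ?S = "S_matrix ?\<rho> (p \<theta>)" and ?Q = "Q_matrix ?\<rho> q \<theta>" and ?R = "R_matrix ?\<rho> M \<theta>"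
  obtain E w where sd: "spectral_decomp ?\<rho> E w"
    \<comment> \<open>Any pair of indices serves, since \<open>has_state_trace\<close> includes the
      existence of a spectral decomposition.\<close>
    using S_finite[OF \<theta>, of undefined undefined] unfolding has_state_trace_def by (elim exE conjE)
  have w: "0 < w e" if "e \<in> E" for e using sd that unfolding spectral_decomp_def by simp
  have st: "E \<subseteq> udom X \<and> ((\<lambda>e. of_real (w e) * cinner (uapp X e) (uapp Y e)) has_sum state_Tr ?\<rho> X Y) E"
    if ex: "\<exists>t. has_state_trace ?\<rho> X Y t" for X Y
  proof -
    obtain t where t: "has_state_trace ?\<rho> X Y t" using ex by (elim exE)
    then show ?thesis using sd unfolding state_Tr_eq[OF t] has_state_trace_def by simp
  qed
  have p_dom: "E \<subseteq> udom (p \<theta> k)" for k using st[OF S_finite[OF \<theta>], of k k] by simp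
  have p_sum: "((\<lambda>e. of_real (w e) * cinner (uapp (p \<theta> i) e) (uapp (p \<theta> k) e)) has_sum
      state_Tr ?\<rho> (p \<theta> i) (p \<theta> k)) E" for i k
    using st[OF S_finite[OF \<theta>], of i k] by simp
  define v where "v i e = uapp (q i) e - \<theta> $ i *\<^sub>R e" for i e
  have q_dom: "E \<subseteq> udom (q i)" for i using st[OF Q_finite[OF \<theta>], of i i] by (simp add: shift_op_def)
  have q_sum: "((\<lambda>e. of_real (w e) * cinner (v i e) (v k e)) has_sum ?Q $ i $ k) E" for i k
    using st[OF Q_finite[OF \<theta>], of i k] by (simp add: shift_op_def v_def Q_matrix_def)
  have q_herm: "hermitian_op (q i)" for i using q_integral unfolding is_qpm_integral_def by blast
  note q_form = gram_form_has_sum[where v = v and A = "\<lambda>i k. ?Q $ i $ k", OF q_sum]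

  have cross: "((\<lambda>e. w e * Im (cinner (uapp (p \<theta> k) e) (v i e))) has_sum
      (- (hbar / 2) * axis k 1 $ i)) E" for i k
  proof -
    obtain d where d: "has_op_trace (lmult_op (partial_op k \<rho> \<theta>) (q i)) d"
      and deriv: "((\<lambda>t. op_Tr (lmult_op (\<rho> (\<theta> + t *\<^sub>R axis k 1)) (q i))) has_vector_derivative d) (at 0)"
      using interchange[OF \<theta>, of k i] by (elim exE conjE)
    \<comment> \<open>Unbiasedness on the whole of \<Theta> pins down the derivative whose existence
      is granted by \<open>interchange\<close>.\<close>
    have d_eq: "d = of_real (axis k 1 $ i)"
      by (rule unbiased_derivative[OF open_\<Theta> \<theta> _ deriv]) (rule op_Tr_eq[OF unbiased])
    obtain D where D: "has_trace D d" "\<And>x. x \<in> udom (q i) \<Longrightarrow> D x = partial_op k \<rho> \<theta> (uapp (q i) x)"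
      using d unfolding has_op_trace_def lmult_op_def by auto
    show ?thesis
      unfolding v_def
    proof (rule unbiased_commutator_sum[OF density[OF \<theta>] sd herm_p[OF \<theta>] p_dom _ q_herm q_dom _ _
          commutator[OF \<theta>] hbar D(1)[unfolded d_eq] D(2)])
      show "(\<lambda>e. w e * (norm (uapp (p \<theta> k) e))\<^sup>2) summable_on E"
        by (rule state_trace_norm_summable[OF p_sum])
      show "(\<lambda>e. w e * (norm (uapp (q i) e - \<theta> $ i *\<^sub>R e))\<^sup>2) summable_on E"
        using state_trace_norm_summable[OF q_sum, of i] by (simp add: v_def)
      show "inner y (partial_op k \<rho> \<theta> x) = inner x (partial_op k \<rho> \<theta> y)" for x y
        using density by (intro partial_op_symmetric[OF open_\<Theta> \<theta> smooth]) (simp add: density_operator_def)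
    qed
  qed

  have R_ge: "matrix_ge ?R ?Q"
    unfolding matrix_ge_def
  proof
    fix c :: "real^'n"
    let ?r = "\<Sum>i\<in>UNIV. \<Sum>k\<in>UNIV. c $ i * c $ k * (\<integral>l. (l $ i - \<theta> $ i) * (l $ k - \<theta> $ k) \<partial>?N)"
    let ?s = "\<Sum>i\<in>UNIV. \<Sum>k\<in>UNIV. ?Q $ i $ k * of_real (c $ i) * of_real (c $ k)"
    \<comment> \<open>The variance bound holds with the same right side for every finite set of
      eigenvectors, hence for the full sum.\<close>
    have "Re ?s \<le> ?r"
      using qpm_variance_bound[OF qpm q_integral density[OF \<theta>] sd q_dom R_finite[OF \<theta>]]
      by (intro has_sum_le_finite_sums[OF q_form(1)]) (simp add: v_def)
    moreover have "(\<Sum>i\<in>UNIV. \<Sum>k\<in>UNIV. (?R $ i $ k - ?Q $ i $ k) * of_real (c $ i) * of_real (c $ k))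
        = of_real ?r - ?s"
    proof -
      have "(\<Sum>i\<in>UNIV. \<Sum>k\<in>UNIV. (?R $ i $ k - ?Q $ i $ k) * of_real (c $ i) * of_real (c $ k))
          = (\<Sum>i\<in>UNIV. \<Sum>k\<in>UNIV. ?R $ i $ k * of_real (c $ i) * of_real (c $ k)) - ?s"
        by (simp only: left_diff_distrib sum_subtractf)
      then show ?thesis by (simp add: R_matrix_def mult_ac)
    qed
    \<comment> \<open>Entries of Q may be complex; reality of its form at a real c reduces the claim
      to the comparison of real parts.\<close>
    moreover have "of_real ?r - ?s = of_real (?r - Re ?s)"
      using q_form(2)[where c = "\<lambda>i. c $ i"] by (simp only: of_real_diff of_real_Re)
    ultimately show "(\<Sum>i\<in>UNIV. \<Sum>k\<in>UNIV. (?R $ i $ k - ?Q $ i $ k) * of_real (c $ i) * of_real (c $ k)) \<in> \<real>\<^sub>\<ge>\<^sub>0"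
      by (simp only: nonneg_Reals_of_real_iff diff_ge_0_iff_ge)
  qed

  \<comment> \<open>Exchanging the two factors conjugates a trace, so the symmetrized entries are
    real. This is what allows S d = c to be solved by a real vector d.\<close>
  have S_real: "?S $ i $ k \<in> \<real>" for i k
  proof -
    have "((\<lambda>e. cnj (of_real (w e) * cinner (uapp (p \<theta> i) e) (uapp (p \<theta> k) e))) has_sum
        cnj (state_Tr ?\<rho> (p \<theta> i) (p \<theta> k))) E"
      using p_sum[of i k] by (simp only: has_sum_cnj_iff)
    moreover have "cnj (of_real (w e) * cinner x y) = of_real (w e) * cinner y x" for e x and y :: 'h
      by (simp add: cinner_commute[of y x])
    ultimately have "state_Tr ?\<rho> (p \<theta> k) (p \<theta> i) = cnj (state_Tr ?\<rho> (p \<theta> i) (p \<theta> k))"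
      using has_sum_unique[OF p_sum[of k i]] by (simp only:)
    then show ?thesis by (simp add: S_matrix_def complex_is_Real_iff)
  qed

  have "matrix_ge ?Q ((hbar\<^sup>2 / 4) *\<^sub>R matrix_inv ?S)"
    unfolding matrix_ge_def
  proof
    fix c :: "real^'n"
    obtain d :: "real^'n"
      where inv_c: "\<And>i. (\<Sum>k\<in>UNIV. matrix_inv ?S $ i $ k * of_real (c $ k)) = of_real (d $ i)"
        and S_d: "\<And>i. (\<Sum>k\<in>UNIV. ?S $ i $ k * of_real (d $ k)) = of_real (c $ i)"
      using real_matrix_inv_solution[OF S_nondegenerate[OF \<theta>] S_real] by blast
    let ?s = "\<Sum>i\<in>UNIV. \<Sum>k\<in>UNIV. ?Q $ i $ k * of_real (c $ i) * of_real (c $ k)"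
    \<comment> \<open>As d is the inverse of S applied to c, this number is the quadratic form of
      the inverse at c.\<close>
    define cd where "cd = (\<Sum>i\<in>UNIV. c $ i * d $ i)"
    define Z where "Z e = (\<Sum>i\<in>UNIV. c $ i *\<^sub>R v i e)" for e
    define Y where "Y e = (\<Sum>k\<in>UNIV. d $ k *\<^sub>R uapp (p \<theta> k) e)" for e
    have Z: "((\<lambda>e. w e * (norm (Z e))\<^sup>2) has_sum Re ?s) E"
      unfolding Z_def by (rule q_form(1))
    have Y: "((\<lambda>e. w e * (norm (Y e))\<^sup>2) has_sum cd) E"
    proof -
      let ?t = "\<lambda>i k. state_Tr ?\<rho> (p \<theta> i) (p \<theta> k) * of_real (d $ i) * of_real (d $ k)"
      have "(\<Sum>i\<in>UNIV. \<Sum>k\<in>UNIV. ?S $ i $ k * of_real (d $ i) * of_real (d $ k))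
          = ((\<Sum>i\<in>UNIV. \<Sum>k\<in>UNIV. ?t i k) + (\<Sum>i\<in>UNIV. \<Sum>k\<in>UNIV. ?t k i)) / 2"
        unfolding sum.distrib[symmetric] sum_divide_distrib
        by (intro sum.cong refl) (simp add: S_matrix_def field_simps)
      \<comment> \<open>At a real vector the symmetrization in S is invisible, so the form of S
        coincides with the Gram form of the p_k.\<close>
      also have "(\<Sum>i\<in>UNIV. \<Sum>k\<in>UNIV. ?t k i) = (\<Sum>i\<in>UNIV. \<Sum>k\<in>UNIV. ?t i k)" by (rule sum.swap)
      also have "(x + x) / 2 = x" for x :: complex by simp
      finally have "(\<Sum>i\<in>UNIV. \<Sum>k\<in>UNIV. ?t i k)
          = (\<Sum>i\<in>UNIV. \<Sum>k\<in>UNIV. ?S $ i $ k * of_real (d $ i) * of_real (d $ k))" ..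
      also have "\<dots> = (\<Sum>i\<in>UNIV. of_real (d $ i) * (\<Sum>k\<in>UNIV. ?S $ i $ k * of_real (d $ k)))"
        unfolding sum_distrib_left by (simp only: mult_ac)
      also have "\<dots> = of_real cd" unfolding S_d cd_def by (simp add: mult.commute)
      finally show ?thesis
        unfolding Y_def
        using gram_form_has_sum(1)[where v = "\<lambda>k. uapp (p \<theta> k)" and c = "\<lambda>i. d $ i"
            and A = "\<lambda>i k. state_Tr ?\<rho> (p \<theta> i) (p \<theta> k)", OF p_sum]
        by simp
    qed
    have YZ: "((\<lambda>e. w e * Im (cinner (Y e) (Z e))) has_sum (- (hbar / 2) * cd)) E"
    proof -
      have "w e * Im (cinner (Y e) (Z e))
          = (\<Sum>k\<in>UNIV. \<Sum>i\<in>UNIV. (d $ k * c $ i) * (w e * Im (cinner (uapp (p \<theta> k) e) (v i e))))" for e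
        unfolding Y_def Z_def cinner_sum_left
        unfolding cinner_sum_right cinner_scaleR_left cinner_scaleR_right
        by (simp add: sum_distrib_left mult_ac)
      moreover have "((\<lambda>e. \<Sum>k\<in>UNIV. \<Sum>i\<in>UNIV. (d $ k * c $ i) * (w e * Im (cinner (uapp (p \<theta> k) e) (v i e)))) has_sum
          (\<Sum>k\<in>UNIV. \<Sum>i\<in>UNIV. (d $ k * c $ i) * (- (hbar / 2) * axis k 1 $ i))) E"
        by (intro has_sum_sum has_sum_cmult_right cross)
      moreover have "(\<Sum>i\<in>UNIV. (d $ k * c $ i) * (- (hbar / 2) * axis k 1 $ i)) = - (hbar / 2) * (c $ k * d $ k)" for k
      proof -
        have "(\<Sum>i\<in>UNIV. (d $ k * c $ i) * (- (hbar / 2) * axis k 1 $ i))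
            = (\<Sum>i\<in>UNIV. if i = k then - (hbar / 2) * (c $ k * d $ k) else 0)"
          by (intro sum.cong refl) (auto simp: axis_def)
        then show ?thesis by simp
      qed
      ultimately show ?thesis by (simp only: cd_def sum_distrib_left)
    qed
    \<comment> \<open>The cross term sums to -(hbar^2/2) \<open>cd\<close> and the last one to
      (hbar^2/4) \<open>cd\<close>, so nonnegativity of the total is exactly the desired lower bound
      on Q.\<close>
    have "((\<lambda>e. w e * (norm (Z e))\<^sup>2 + hbar * (w e * Im (cinner (Y e) (Z e))) + hbar\<^sup>2 / 4 * (w e * (norm (Y e))\<^sup>2))
        has_sum (Re ?s + hbar * (- (hbar / 2) * cd) + hbar\<^sup>2 / 4 * cd)) E"
      by (intro has_sum_add has_sum_cmult_right Y Z YZ)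
    moreover have "0 \<le> w e * (norm (Z e))\<^sup>2 + hbar * (w e * Im (cinner (Y e) (Z e))) + hbar\<^sup>2 / 4 * (w e * (norm (Y e))\<^sup>2)"
      if "e \<in> E" for e
      using mult_nonneg_nonneg[OF less_imp_le[OF w[OF that]] uncertainty_termwise[of hbar "Z e" "Y e"]] hbar
      by (simp add: algebra_simps)
    ultimately have "0 \<le> Re ?s + hbar * (- (hbar / 2) * cd) + hbar\<^sup>2 / 4 * cd"
      by (rule has_sum_nonneg)
    then have "0 \<le> Re ?s - hbar\<^sup>2 / 4 * cd" by (simp add: power2_eq_square algebra_simps)
    moreover have "(\<Sum>i\<in>UNIV. \<Sum>k\<in>UNIV. (?Q $ i $ k - ((hbar\<^sup>2 / 4) *\<^sub>R matrix_inv ?S) $ i $ k) * of_real (c $ i) * of_real (c $ k))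
        = of_real (Re ?s - hbar\<^sup>2 / 4 * cd)"
    proof -
      have "(\<Sum>i\<in>UNIV. \<Sum>k\<in>UNIV. ((hbar\<^sup>2 / 4) *\<^sub>R matrix_inv ?S) $ i $ k * of_real (c $ i) * of_real (c $ k))
          = of_real (hbar\<^sup>2 / 4) * (\<Sum>i\<in>UNIV. of_real (c $ i) * (\<Sum>k\<in>UNIV. matrix_inv ?S $ i $ k * of_real (c $ k)))"
        unfolding sum_distrib_left
        by (intro sum.cong refl) (simp only: vector_scaleR_component, simp only: scaleR_conv_of_real mult_ac)
      also have "\<dots> = of_real (hbar\<^sup>2 / 4 * cd)" unfolding inv_c cd_def by simp
      finally have "(\<Sum>i\<in>UNIV. \<Sum>k\<in>UNIV. (?Q $ i $ k - ((hbar\<^sup>2 / 4) *\<^sub>R matrix_inv ?S) $ i $ k) * of_real (c $ i) * of_real (c $ k))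
          = ?s - of_real (hbar\<^sup>2 / 4 * cd)"
        unfolding left_diff_distrib sum_subtractf by (simp only:)
      then show ?thesis using q_form(2)[where c = "\<lambda>i. c $ i"] by (simp only: of_real_diff of_real_Re)
    qed
    ultimately show "(\<Sum>i\<in>UNIV. \<Sum>k\<in>UNIV. (?Q $ i $ k - ((hbar\<^sup>2 / 4) *\<^sub>R matrix_inv ?S) $ i $ k) * of_real (c $ i) * of_real (c $ k)) \<in> \<real>\<^sub>\<ge>\<^sub>0"
      by (simp only: nonneg_Reals_of_real_iff)
  qed
  with R_ge show "matrix_ge ?R ?Q \<and> matrix_ge ?Q ((hbar\<^sup>2 / 4) *\<^sub>R matrix_inv ?S)" ..
qed

end
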